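(* Assume that continuous functions are dense in $N^1X(\mathcal P)$ (i.e. for every $u\in N^1X(\mathcal P)$ and $\varepsilon>0$ there is a continuous $v\in N^1X(\mathcal P)$ with $\|u-v\|_{N^1X}<\varepsilon$). Then properties (A), (B), (C), (D), (E) are all equivalent, and (F) and (G) hold. Moreover, there exist a compact metric space $\mathcal P$ (satisfying the standing assumptions) and a Banach function lattice $X$ such that continuous functions are dense in $N^1X(\mathcal P)$ but (A)–(E) all fail.
   Context: Standing assumptions: $\mathcal P=(\mathcal P,d,\mu)$ is a metric space with a positive complete Borel measure $\mu$ such that $0<\mu(B)<\infty$ for every ball $B$; $\mu$ is extended as an outer measure to all subsets. $\overline{\mathbf R}=[-\infty,\infty]$. A quasi-Banach function lattice $X=X(\mathcal P)$ is a vector space of extended real-valued measurable functions defined everywhere on $\mathcal P$ with a functional $\|\cdot\|_X$ such that: $X=\{u:\|u\|_X<\infty\}$; $\|u\|_X=0$ iff $u=0$ a.e., $\|au\|_X=|a|\|u\|_X$, and $\|u+v\|_X\le c_\wedge(\|u\|_X+\|v\|_X)$ for some $c_\wedge\ge1$; $|u|\le|v|$ a.e. implies $\|u\|_X\le\|v\|_X$; and if $u_n\ge0$ a.e. then $\|\sum_{n\ge1}u_n\|_X\le\sum_{n\ge1}c_\wedge^n\|u_n\|_X$. The quasinorm is assumed continuous: $\|u_n-u\|_X\to0$ implies $\|u_n\|_X\to\|u\|_X$. If $c_\wedge=1$, $X$ is a Banach function lattice. A Borel $g:\mathcal P\to[0,\infty]$ is an upper gradient of $u:\mathcal P\to\overline{\mathbf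 R}$ if $|u(\gamma(0))-u(\gamma(l_\gamma))|\le\int_\gamma g\,ds$ for every nonconstant rectifiable (arc-length parametrized) curve $\gamma:[0,l_\gamma]\to\mathcal P$. $N^1X(\mathcal P)=\{u\in X:\|u\|_{N^1X}:=\|u\|_X+\inf_g\|g\|_X<\infty\}$, infimum over upper gradients. $C_X(E)=\inf\{\|u\|_{N^1X}:u\in N^1X,\ u\ge1\text{ on }E\}$; "q.e." means outside a set of zero capacity. $C_X$ is a $c$-quasiouter capacity ($c\ge1$) if $\inf\{C_X(G):G\supset E\text{ open}\}\le cC_X(E)$ for all $E$; quasiouter if this holds for some $c$; outer if with $c=1$; outer for sets of zero capacity if whenever $C_X(E)=0$ and $\varepsilon>0$ there is open $G\supset E$ with $C_X(G)<\varepsilon$. $u:\mathcal P\to\overline{\mathbf R}$ is weakly quasicontinuous if for every $\varepsilon>0$ there is $E$ with $C_X(E)<\varepsilon$ and $u|_{\mathcal P\setminus E}$ (real-valued) continuous; quasicontinuous if $E$ can be chosen open. Properties: (A) every $u\in N^1X(\mathcal P)$ is quasicontinuous; (B) $C_X$ is outer; (C) $C_X$ is quasiouter; (D) every weakly quasicontinuous $u:\mathcal P\to\overline{\mathbf R}$ is quasicontinuous; (E) $C_X$ is outer for sets of zero capacity; (F) every $u\in N^1X(\mathcal P)$ has a quasicontinuous $v$ with $v=u$ q.e.; (G) every $u\in N^1X(\mathcal P)$ is weakly quasicontinuous. *)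

theory Defs
  imports "HOL-Analysis.Analysis" "HOL-Probability.Probability"
begin

definition mtop :: "'a set \<Rightarrow> ('a \<Rightarrow> 'a \<Rightarrow> real) \<Rightarrow> 'a topology" where
  "mtop M d = Metric_space.mtopology M d"

definition borel_mspace :: "'a set \<Rightarrow> ('a \<Rightarrow> 'a \<Rightarrow> real) \<Rightarrow> 'a measure" where
  "borel_mspace M d = sigma M {U. openin (mtop M d) U}"

definition standing :: "'a set \<Rightarrow> ('a \<Rightarrow> 'a \<Rightarrow> real) \<Rightarrow> 'a measure \<Rightarrow> bool" where
  "standing M d mu \<longleftrightarrow>
     Metric_space M d \<and> space mu = M \<and>
     sets (borel_mspace M d) \<subseteq> sets mu \<and>
     complete_measure mu \<and>
     (\<forall>x\<in>M. \<forall>r>0. 0 < emeasure mu (Metric_space.mball M d x r) \<and>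
                   emeasure mu (Metric_space.mball M d x r) < \<infinity>)"

definition lattice_X :: "'a measure \<Rightarrow> (('a \<Rightarrow> ereal) \<Rightarrow> ennreal) \<Rightarrow> ('a \<Rightarrow> ereal) set" where
  "lattice_X mu nX = {u. u \<in> borel_measurable mu \<and> nX u < \<infinity>}"

definition qBFL :: "'a measure \<Rightarrow> (('a \<Rightarrow> ereal) \<Rightarrow> ennreal) \<Rightarrow> real \<Rightarrow> bool" where
  "qBFL mu nX c \<longleftrightarrow> c \<ge> 1 \<and>
     (\<forall>u \<in> borel_measurable mu. nX u = 0 \<longleftrightarrow> (AE x in mu. u x = 0)) \<and>
     (\<forall>u \<in> borel_measurable mu. \<forall>a::real.
         nX (\<lambda>x. ereal a * u x) = ennreal \<bar>a\<bar> * nX u) \<and>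
     (\<forall>u \<in> borel_measurable mu. \<forall>v \<in> borel_measurable mu.
         nX (\<lambda>x. u x + v x) \<le> ennreal c * (nX u + nX v)) \<and>
     (\<forall>u \<in> borel_measurable mu. \<forall>v \<in> borel_measurable mu.
         (AE x in mu. \<bar>u x\<bar> \<le> \<bar>v x\<bar>) \<longrightarrow> nX u \<le> nX v) \<and>
     (\<forall>us. (\<forall>n. us n \<in> borel_measurable mu) \<longrightarrow> (\<forall>n. AE x in mu. us n x \<ge> 0) \<longrightarrow>
         nX (\<lambda>x. \<Sum>n. us n x) \<le> (\<Sum>n. ennreal (c ^ Suc n) * nX (us n))) \<and>
     (\<forall>u us. u \<in> lattice_X mu nX \<longrightarrow> (\<forall>n. us n \<in> lattice_X mu nX) \<longrightarrow>
         (\<lambda>n. nX (\<lambda>x. us n x - u x)) \<longlonglongrightarrow> 0 \<longrightarrow> (\<lambda>n. nX (us n)) \<longlonglongrightarrow> nX u)"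

definition curve_length :: "('a \<Rightarrow> 'a \<Rightarrow> real) \<Rightarrow> (real \<Rightarrow> 'a) \<Rightarrow> real \<Rightarrow> real \<Rightarrow> ereal" where
  "curve_length d \<gamma> s t =
     (SUP (p, n) \<in> {(p :: nat \<Rightarrow> real, n :: nat). p 0 = s \<and> p n = t \<and> (\<forall>i<n. p i \<le> p (Suc i))}.
        ereal (\<Sum>i<n. d (\<gamma> (p i)) (\<gamma> (p (Suc i)))))"

definition arclength_curve :: "'a set \<Rightarrow> ('a \<Rightarrow> 'a \<Rightarrow> real) \<Rightarrow> (real \<Rightarrow> 'a) \<Rightarrow> real \<Rightarrow> bool" where
  "arclength_curve M d \<gamma> l \<longleftrightarrow> 0 < l \<and> \<gamma> ` {0..l} \<subseteq> M \<and>
     (\<forall>s t. 0 \<le> s \<longrightarrow> s \<le> t \<longrightarrow> t \<le> l \<longrightarrow> curve_length d \<gamma> s t = ereal (t - s))"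

definition line_integral :: "('a \<Rightarrow> ennreal) \<Rightarrow> (real \<Rightarrow> 'a) \<Rightarrow> real \<Rightarrow> ennreal" where
  "line_integral g \<gamma> l = (\<integral>\<^sup>+ t. g (\<gamma> t) * indicator {0..l} t \<partial>lborel)"

text \<open>Upper gradient; following the usual convention, the left-hand side is \<infinity>
  if u(\<gamma>(0)) or u(\<gamma>(l)) is infinite.\<close>
definition upper_gradient ::
  "'a set \<Rightarrow> ('a \<Rightarrow> 'a \<Rightarrow> real) \<Rightarrow> ('a \<Rightarrow> ennreal) \<Rightarrow> ('a \<Rightarrow> ereal) \<Rightarrow> bool" where
  "upper_gradient M d g u \<longleftrightarrow> g \<in> borel_measurable (borel_mspace M d) \<and>
     (\<forall>\<gamma> l. arclength_curve M d \<gamma> l \<longrightarrow>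
        (if \<bar>u (\<gamma> 0)\<bar> \<noteq> \<infinity> \<and> \<bar>u (\<gamma> l)\<bar> \<noteq> \<infinity>
         then ennreal (real_of_ereal \<bar>u (\<gamma> 0) - u (\<gamma> l)\<bar>) \<le> line_integral g \<gamma> l
         else line_integral g \<gamma> l = \<infinity>))"

definition N1norm :: "'a set \<Rightarrow> ('a \<Rightarrow> 'a \<Rightarrow> real) \<Rightarrow> (('a \<Rightarrow> ereal) \<Rightarrow> ennreal)
    \<Rightarrow> ('a \<Rightarrow> ereal) \<Rightarrow> ennreal" where
  "N1norm M d nX u = nX u + (INF g \<in> {g. upper_gradient M d g u}. nX (\<lambda>x. enn2ereal (g x)))"

definition N1X :: "'a set \<Rightarrow> ('a \<Rightarrow> 'a \<Rightarrow> real) \<Rightarrow> 'a measure \<Rightarrow> (('a \<Rightarrow> ereal) \<Rightarrow> ennreal)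
    \<Rightarrow> ('a \<Rightarrow> ereal) set" where
  "N1X M d mu nX = {u \<in> lattice_X mu nX. N1norm M d nX u < \<infinity>}"

definition capX :: "'a set \<Rightarrow> ('a \<Rightarrow> 'a \<Rightarrow> real) \<Rightarrow> 'a measure \<Rightarrow> (('a \<Rightarrow> ereal) \<Rightarrow> ennreal)
    \<Rightarrow> 'a set \<Rightarrow> ennreal" where
  "capX M d mu nX E = (INF u \<in> {u \<in> N1X M d mu nX. \<forall>x\<in>E. u x \<ge> 1}. N1norm M d nX u)"

definition cont_off :: "'a set \<Rightarrow> ('a \<Rightarrow> 'a \<Rightarrow> real) \<Rightarrow> 'a set \<Rightarrow> ('a \<Rightarrow> ereal) \<Rightarrow> bool" where
  "cont_off M d E u \<longleftrightarrow> (\<forall>x \<in> M - E. \<bar>u x\<bar> \<noteq> \<infinity>) \<and>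
     continuous_map (subtopology (mtop M d) (M - E)) euclideanreal (\<lambda>x. real_of_ereal (u x))"

definition weakly_qc :: "'a set \<Rightarrow> ('a \<Rightarrow> 'a \<Rightarrow> real) \<Rightarrow> 'a measure \<Rightarrow> (('a \<Rightarrow> ereal) \<Rightarrow> ennreal)
    \<Rightarrow> ('a \<Rightarrow> ereal) \<Rightarrow> bool" where
  "weakly_qc M d mu nX u \<longleftrightarrow>
     (\<forall>\<epsilon>>0. \<exists>E \<subseteq> M. capX M d mu nX E < \<epsilon> \<and> cont_off M d E u)"

definition quasicont :: "'a set \<Rightarrow> ('a \<Rightarrow> 'a \<Rightarrow> real) \<Rightarrow> 'a measure \<Rightarrow> (('a \<Rightarrow> ereal) \<Rightarrow> ennreal)
    \<Rightarrow> ('a \<Rightarrow> ereal) \<Rightarrow> bool" where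
  "quasicont M d mu nX u \<longleftrightarrow>
     (\<forall>\<epsilon>>0. \<exists>E. openin (mtop M d) E \<and> capX M d mu nX E < \<epsilon> \<and> cont_off M d E u)"

definition quasiouter_c :: "'a set \<Rightarrow> ('a \<Rightarrow> 'a \<Rightarrow> real) \<Rightarrow> 'a measure \<Rightarrow> (('a \<Rightarrow> ereal) \<Rightarrow> ennreal)
    \<Rightarrow> real \<Rightarrow> bool" where
  "quasiouter_c M d mu nX c \<longleftrightarrow> c \<ge> 1 \<and>
     (\<forall>E \<subseteq> M. (INF G \<in> {G. openin (mtop M d) G \<and> E \<subseteq> G}. capX M d mu nX G)
                 \<le> ennreal c * capX M d mu nX E)"

definition propA where
  "propA M d mu nX \<longleftrightarrow> (\<forall>u \<in> N1X M d mu nX. quasicont M d mu nX u)"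
definition propB where
  "propB M d mu nX \<longleftrightarrow> quasiouter_c M d mu nX 1"
definition propC where
  "propC M d mu nX \<longleftrightarrow> (\<exists>c. quasiouter_c M d mu nX c)"
definition propD where
  "propD M d mu nX \<longleftrightarrow> (\<forall>u. weakly_qc M d mu nX u \<longrightarrow> quasicont M d mu nX u)"
definition propE where
  "propE M d mu nX \<longleftrightarrow> (\<forall>E \<subseteq> M. capX M d mu nX E = 0 \<longrightarrow>
     (\<forall>\<epsilon>>0. \<exists>G. openin (mtop M d) G \<and> E \<subseteq> G \<and> capX M d mu nX G < \<epsilon>))"
definition propF where
  "propF M d mu nX \<longleftrightarrow> (\<forall>u \<in> N1X M d mu nX. \<exists>v. quasicont M d mu nX v \<and>
     capX M d mu nX {x \<in> M. v x \<noteq> u x} = 0)"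
definition propG where
  "propG M d mu nX \<longleftrightarrow> (\<forall>u \<in> N1X M d mu nX. weakly_qc M d mu nX u)"

definition cont_dense where
  "cont_dense M d mu nX \<longleftrightarrow> (\<forall>u \<in> N1X M d mu nX. \<forall>\<epsilon>>0. \<exists>v \<in> N1X M d mu nX.
     cont_off M d {} v \<and> N1norm M d nX (\<lambda>x. u x - v x) < \<epsilon>)"

end

theory Submission
  imports Defs
begin

text \<open>
  Given \<open>u\<close>, choose continuous \<open>w\<^sub>j\<close> converging to \<open>u\<close> so fast that, by the Chebyshev
  inequality for the capacity, the sets \<open>E\<^sub>j = {\<bar>u - w\<^sub>j\<bar> > 2\<^sup>-\<^sup>j}\<close> satisfy
  \<open>C(\<Union>\<^bsub>j\<ge>k\<^esub> E\<^sub>j) \<le> 2\<^sup>-\<^sup>k\<close>. Off these unions the convergence is uniform, which gives (G).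
  The sets \<open>{\<bar>w\<^sub>j - w\<^sub>j\<^sub>+\<^sub>1\<bar> > 2 \<cdot> 2\<^sup>-\<^sup>j}\<close> are open and contained in \<open>E\<^sub>j \<union> E\<^sub>j\<^sub>+\<^sub>1\<close>, so
  \<open>lim w\<^sub>j\<close> is a quasicontinuous representative, which gives (F). Covering the exceptional set of
  (F) by a small open set yields (E) \<open>\<Longrightarrow>\<close> (A). For (A) \<open>\<Longrightarrow>\<close> (B), enlarge an almost optimal \<open>u\<close>
  for \<open>E\<close> slightly so that it is at least 1 on the open set \<open>G \<union> {u > 1 - \<epsilon>}\<close>, where \<open>G\<close> is open
  of small capacity and \<open>u\<close> is continuous off \<open>G\<close>. The implications (B) \<open>\<Longrightarrow>\<close> (C) \<open>\<Longrightarrow>\<close> (E),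
  (B) \<open>\<Longrightarrow>\<close> (D) and (D), (G) \<open>\<Longrightarrow>\<close> (A) are immediate.

  For the counterexample take \<open>{0} \<union> {2\<^sup>-\<^sup>n}\<close> with a measure charging exactly the points
  \<open>2\<^sup>-\<^sup>n\<close>, and the norm \<open>\<Sum>\<^sub>n \<bar>u(2\<^sup>-\<^sup>n)\<bar>\<close>. There are no curves, so this is also the norm of
  \<open>N\<^sup>1X\<close>; the point 0 has capacity zero, but all its neighbourhoods have infinite capacity.
\<close>

section \<open>Extended reals and geometric sequences\<close>

lemma enn2ereal_ennreal_mult:
  "0 \<le> k \<Longrightarrow> enn2ereal (ennreal k * x) = ereal k * enn2ereal x"
  by (simp add: times_ennreal.rep_eq)

lemma enn2ereal_max: "enn2ereal (max a b) = max (enn2ereal a) (enn2ereal b)"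
  by (simp add: max_def less_eq_ennreal.rep_eq)

lemma enn2ereal_SUP: "I \<noteq> {} \<Longrightarrow> enn2ereal (SUP i\<in>I. f i) = (SUP i\<in>I. enn2ereal (f i))"
  by (auto simp: Sup_ennreal.rep_eq image_image intro!: max_absorb2 intro: SUP_upper2)

text \<open>Without subtraction and absolute value, the bound splits into two inequalities of the
  form \<open>p <= q + l\<close>, and these pass to suprema in
  \<open>upper_gradient_SUP\<close>.\<close>

lemma ennreal_real_abs_diff_le_iff:
  fixes p q :: ereal
  assumes "\<bar>p\<bar> \<noteq> \<infinity>" "\<bar>q\<bar> \<noteq> \<infinity>"
  shows "ennreal (real_of_ereal \<bar>p - q\<bar>) \<le> l \<longleftrightarrow> p \<le> q + enn2ereal l \<and> q \<le> p + enn2ereal l"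
  using assms by (cases p; cases q; cases l) (auto simp: ennreal_le_iff)

lemma ennreal_add_lessD: "a + b < e \<Longrightarrow> a \<le> e \<and> b \<le> (e::ennreal)"
  by (metis add.commute le_iff_add less_imp_le order_trans)

text \<open>Makes \<open>upper_gradient_SUP\<close> applicable to the maximum of two functions, seen
  as a family indexed by \<open>bool\<close>.\<close>

lemma SUP_bool_eq_max:
  fixes p q :: "'b::{complete_lattice, linorder}"
  shows "(SUP b. if b then p else q) = max p q"
  by (simp add: UNIV_bool sup_max max.commute)

lemma ex_half_power_less: "0 < (\<epsilon> :: ennreal) \<Longrightarrow> \<exists>k. ennreal ((1 / 2) ^ k) < \<epsilon>"
proof -
  assume "0 < \<epsilon>"
  moreover have "(\<lambda>k. ennreal ((1 / 2) ^ k)) \<longlonglongrightarrow> ennreal 0"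
    by (intro tendsto_ennrealI LIMSEQ_power_zero) simp
  ultimately have "eventually (\<lambda>k. ennreal ((1 / 2) ^ k) < \<epsilon>) sequentially"
    by (intro order_tendstoD(2)) auto
  then show ?thesis
    by (rule eventually_happens'[OF sequentially_bot])
qed

text \<open>Telescoping bounds \<open>f i - f (i + n)\<close> by a geometric tail, uniformly in
  \<open>n\<close>; the bound survives the limit in \<open>n\<close>.\<close>

lemma geometric_Cauchy_limit:
  fixes f :: "nat \<Rightarrow> real"
  assumes "\<And>i. \<bar>f i - f (Suc i)\<bar> \<le> b * (1 / 2) ^ i"
  shows "convergent f" "\<bar>lim f - f i\<bar> \<le> 2 * b * (1 / 2) ^ i"
proof -
  have b: "0 \<le> b"
    using assms[of 0] by simp
  \<comment> \<open>The remainder of the geometric series is subtracted because the weaker bound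
    \<open>**\<close> would not reproduce itself in the induction.\<close>
  have *: "\<bar>f i - f (i + n)\<bar> \<le> 2 * b * (1 / 2) ^ i - 2 * b * (1 / 2) ^ (i + n)" for i n
  proof (induction n)
    case (Suc n)
    then show ?case
      using assms[of "i + n"] by simp
  qed simp
  have **: "\<bar>f i - f (i + n)\<bar> \<le> 2 * b * (1 / 2) ^ i" for i n
    using *[of i n] b by (smt (verit) mult_nonneg_nonneg zero_le_power zero_le_divide_1_iff)
  have "Cauchy f"
  proof (rule CauchyI')
    fix e :: real assume "0 < e"
    moreover have "(\<lambda>i. 2 * b * (1 / 2) ^ i) \<longlonglongrightarrow> 2 * b * 0"
      by (intro tendsto_intros LIMSEQ_power_zero) simp
    ultimately obtain N where N: "2 * b * (1 / 2) ^ i < e" if "N \<le> i" for i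
      using order_tendstoD(2)[of _ "2 * b * 0" sequentially e] by (auto simp: eventually_sequentially)
    have "dist (f m) (f n) < e" if "N \<le> m" "m < n" for m n
      using **[of m "n - m"] N[OF that(1)] that by (simp add: dist_real_def)
    then show "\<exists>M. \<forall>m\<ge>M. \<forall>n>m. dist (f m) (f n) < e"
      by blast
  qed
  then show "convergent f"
    by (simp add: Cauchy_convergent_iff)
  then have "f \<longlonglongrightarrow> lim f"
    by (simp add: convergent_LIMSEQ_iff)
  then have "(\<lambda>n. \<bar>f i - f (i + n)\<bar>) \<longlonglongrightarrow> \<bar>f i - lim f\<bar>"
    by (intro tendsto_intros) (simp add: add.commute LIMSEQ_ignore_initial_segment)
  then have "\<bar>f i - lim f\<bar> \<le> 2 * b * (1 / 2) ^ i"
    by (rule LIMSEQ_le_const2) (use ** in auto)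
  then show "\<bar>lim f - f i\<bar> \<le> 2 * b * (1 / 2) ^ i"
    by (simp add: abs_minus_commute)
qed

lemma half_power_offset_tendsto: "(\<lambda>i. a * (1 / 2) ^ (k + i)) \<longlonglongrightarrow> (0::real)"
proof -
  have "(\<lambda>i. a * (1 / 2) ^ k * (1 / 2) ^ i) \<longlonglongrightarrow> a * (1 / 2) ^ k * (0::real)"
    by (intro tendsto_mult_left LIMSEQ_power_zero) simp
  then show ?thesis
    by (simp add: power_add mult.assoc)
qed

section \<open>Upper gradients\<close>

text \<open>No measurability is assumed, so that it applies to an upper gradient along a curve.\<close>

lemma cmult_nn_integral_le:
  "k * integral\<^sup>N N f \<le> (\<integral>\<^sup>+ x. k * f x \<partial>N)"
proof -
  have "k * integral\<^sup>S N g \<le> (\<integral>\<^sup>+ x. k * f x \<partial>N)" if "simple_function N g" "g \<le> f" for g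
  proof -
    have "k * integral\<^sup>S N g = integral\<^sup>S N (\<lambda>x. k * g x)"
      using that(1) by (rule simple_integral_mult[symmetric])
    also have "\<dots> \<le> (\<integral>\<^sup>+ x. k * f x \<partial>N)"
      unfolding nn_integral_def
      using that by (intro SUP_upper) (auto simp: le_fun_def intro!: mult_left_mono)
    finally show ?thesis .
  qed
  then show ?thesis
    by (auto simp: nn_integral_def[of N f] SUP_mult_left_ennreal intro!: SUP_least)
qed

lemma line_integral_mono:
  "(\<And>x. g x \<le> h x) \<Longrightarrow> line_integral g \<gamma> l \<le> line_integral h \<gamma> l"
  unfolding line_integral_def by (intro nn_integral_mono mult_right_mono) auto

lemma line_integral_cmult_le:
  "k * line_integral g \<gamma> l \<le> line_integral (\<lambda>x. k * g x) \<gamma> l"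
  unfolding line_integral_def
  using cmult_nn_integral_le[of k lborel "\<lambda>t. g (\<gamma> t) * indicator {0..l} t"]
  by (simp add: mult.assoc)

lemma upper_gradientD:
  assumes "upper_gradient M d g u" "arclength_curve M d \<gamma> l"
  shows "\<bar>u (\<gamma> 0)\<bar> \<noteq> \<infinity> \<Longrightarrow> \<bar>u (\<gamma> l)\<bar> \<noteq> \<infinity> \<Longrightarrow>
      ennreal (real_of_ereal \<bar>u (\<gamma> 0) - u (\<gamma> l)\<bar>) \<le> line_integral g \<gamma> l"
    and "\<bar>u (\<gamma> 0)\<bar> = \<infinity> \<or> \<bar>u (\<gamma> l)\<bar> = \<infinity> \<Longrightarrow> line_integral g \<gamma> l = \<infinity>"
  using assms unfolding upper_gradient_def by metis+

lemma abs_min_diff_le: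
  fixes x y z :: real
  shows "\<bar>min z x - min z y\<bar> \<le> \<bar>x - y\<bar>"
  by (auto simp: min_def)

text \<open>The map taking \<open>r\<close> to \<open>min 1 (k * |r|)\<close> is
  \<open>k\<close>-Lipschitz on the reals and finite even at infinite \<open>r\<close>. It is used
  with \<open>k = 1\<close> to normalise test functions, with large \<open>k\<close> for Chebyshev's
  inequality, and with \<open>k\<close> slightly above 1 for (B).\<close>

lemma upper_gradient_truncate:
  assumes ug: "upper_gradient M d g u" and k: "0 < k"
  shows "upper_gradient M d (\<lambda>x. ennreal k * g x) (\<lambda>x. min 1 (ereal k * \<bar>u x\<bar>))"
  unfolding upper_gradient_def
proof (intro conjI allI impI)
  show "(\<lambda>x. ennreal k * g x) \<in> borel_measurable (borel_mspace M d)"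
    using ug by (auto simp: upper_gradient_def)
next
  fix \<gamma> l assume \<gamma>: "arclength_curve M d \<gamma> l"
  define p q where "p = u (\<gamma> 0)" and "q = u (\<gamma> l)"
  define L L' where "L = line_integral g \<gamma> l" and "L' = line_integral (\<lambda>x. ennreal k * g x) \<gamma> l"
  have L: "ennreal k * L \<le> L'"
    unfolding L_def L'_def by (rule line_integral_cmult_le)
  have f: "\<bar>min 1 (ereal k * \<bar>r\<bar>)\<bar> \<noteq> \<infinity>" for r :: ereal
    using k by (cases r) (auto simp: min_def)
  have "ennreal (real_of_ereal \<bar>min 1 (ereal k * \<bar>p\<bar>) - min 1 (ereal k * \<bar>q\<bar>)\<bar>) \<le> L'"
  proof (cases "\<bar>p\<bar> \<noteq> \<infinity> \<and> \<bar>q\<bar> \<noteq> \<infinity>")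
    case True
    then obtain a b where ab: "p = ereal a" "q = ereal b"
      by auto
    have "ennreal \<bar>a - b\<bar> \<le> L"
      using upper_gradientD(1)[OF ug \<gamma>] ab by (simp add: p_def q_def L_def)
    then have "ennreal k * ennreal \<bar>a - b\<bar> \<le> ennreal k * L"
      by (intro mult_left_mono) auto
    with L have "ennreal (k * \<bar>a - b\<bar>) \<le> L'"
      using k by (simp add: ennreal_mult')
    moreover have "\<bar>min 1 (k * \<bar>a\<bar>) - min 1 (k * \<bar>b\<bar>)\<bar> \<le> k * \<bar>a - b\<bar>"
    proof -
      have "\<bar>min 1 (k * \<bar>a\<bar>) - min 1 (k * \<bar>b\<bar>)\<bar> \<le> \<bar>k * \<bar>a\<bar> - k * \<bar>b\<bar>\<bar>"
        by (rule abs_min_diff_le)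
      also have "\<dots> = \<bar>k * (\<bar>a\<bar> - \<bar>b\<bar>)\<bar>"
        by (simp only: right_diff_distrib)
      also have "\<dots> = k * \<bar>\<bar>a\<bar> - \<bar>b\<bar>\<bar>"
        using k by (simp only: abs_mult abs_of_pos)
      also have "\<dots> \<le> k * \<bar>a - b\<bar>"
        using k by (intro mult_left_mono abs_triangle_ineq3) simp
      finally show ?thesis .
    qed
    moreover have "real_of_ereal \<bar>min 1 (ereal k * \<bar>p\<bar>) - min 1 (ereal k * \<bar>q\<bar>)\<bar>
        = \<bar>min 1 (k * \<bar>a\<bar>) - min 1 (k * \<bar>b\<bar>)\<bar>"
      by (simp add: ab one_ereal_def min_def del: ereal_eq_1)
    ultimately show ?thesis
      by (metis ennreal_leI order_trans)
  next
    case False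
    \<comment> \<open>An infinite endpoint value of \<open>u\<close> forces an infinite integral of
      \<open>g\<close>, and the factor \<open>k > 0\<close> keeps it infinite.\<close>
    then have "L = \<infinity>"
      using upper_gradientD(2)[OF ug \<gamma>] by (auto simp: p_def q_def L_def)
    then have "L' = \<infinity>"
      using L k by (simp add: ennreal_mult_top top_unique)
    then show ?thesis by simp
  qed
  then show "if \<bar>min 1 (ereal k * \<bar>u (\<gamma> 0)\<bar>)\<bar> \<noteq> \<infinity> \<and> \<bar>min 1 (ereal k * \<bar>u (\<gamma> l)\<bar>)\<bar> \<noteq> \<infinity>
    then ennreal (real_of_ereal \<bar>min 1 (ereal k * \<bar>u (\<gamma> 0)\<bar>) - min 1 (ereal k * \<bar>u (\<gamma> l)\<bar>)\<bar>)
          \<le> line_integral (\<lambda>x. ennreal k * g x) \<gamma> l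
    else line_integral (\<lambda>x. ennreal k * g x) \<gamma> l = \<infinity>"
    using f by (simp add: p_def q_def L'_def)
qed

text \<open>
  Suprema replace the sums usual in this context: the supremum of functions with values in
  $[0,1]$ stays finite, so the clause of \<^const>\<open>upper_gradient\<close> for infinite values never arises.
\<close>

lemma upper_gradient_SUP:
  fixes u :: "'i::countable \<Rightarrow> 'a \<Rightarrow> ereal"
  assumes ug: "\<And>i. upper_gradient M d (g i) (u i)" and u: "\<And>i x. 0 \<le> u i x \<and> u i x \<le> 1"
  shows "upper_gradient M d (\<lambda>x. SUP i. g i x) (\<lambda>x. SUP i. u i x)"
  unfolding upper_gradient_def
proof (intro conjI allI impI)
  show "(\<lambda>x. SUP i. g i x) \<in> borel_measurable (borel_mspace M d)"
    using ug by (intro borel_measurable_SUP) (auto simp: upper_gradient_def)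
next
  fix \<gamma> l assume \<gamma>: "arclength_curve M d \<gamma> l"
  let ?L = "enn2ereal (line_integral (\<lambda>x. SUP i. g i x) \<gamma> l)"
  have fin: "\<bar>r\<bar> \<noteq> \<infinity>" if "0 \<le> r \<and> r \<le> 1" for r :: ereal
    using that by (cases r) auto
  have S: "0 \<le> (SUP i. u i x) \<and> (SUP i. u i x) \<le> 1" for x
    using u by (auto intro!: SUP_least intro: SUP_upper2)
  have L: "enn2ereal (line_integral (g i) \<gamma> l) \<le> ?L" for i
    unfolding less_eq_ennreal.rep_eq[symmetric] by (intro line_integral_mono SUP_upper) auto
  have *: "u i (\<gamma> 0) \<le> u i (\<gamma> l) + ?L \<and> u i (\<gamma> l) \<le> u i (\<gamma> 0) + ?L" for i
  proof -
    have "ennreal (real_of_ereal \<bar>u i (\<gamma> 0) - u i (\<gamma> l)\<bar>) \<le> line_integral (g i) \<gamma> l"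
      using fin[OF u] by (intro upper_gradientD(1)[OF ug \<gamma>])
    then show ?thesis
      using L[of i] fin[OF u]
      by (simp add: ennreal_real_abs_diff_le_iff) (meson add_left_mono order_trans)
  qed
  have "ennreal (real_of_ereal \<bar>(SUP i. u i (\<gamma> 0)) - (SUP i. u i (\<gamma> l))\<bar>)
      \<le> line_integral (\<lambda>x. SUP i. g i x) \<gamma> l"
    unfolding ennreal_real_abs_diff_le_iff[OF fin[OF S] fin[OF S]]
    by (auto intro!: SUP_least order_trans[OF conjunct1[OF *]] order_trans[OF conjunct2[OF *]]
        add_right_mono SUP_upper)
  then show "if \<bar>SUP i. u i (\<gamma> 0)\<bar> \<noteq> \<infinity> \<and> \<bar>SUP i. u i (\<gamma> l)\<bar> \<noteq> \<infinity>
    then ennreal (real_of_ereal \<bar>(SUP i. u i (\<gamma> 0)) - (SUP i. u i (\<gamma> l))\<bar>)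
          \<le> line_integral (\<lambda>x. SUP i. g i x) \<gamma> l
    else line_integral (\<lambda>x. SUP i. g i x) \<gamma> l = \<infinity>"
    using fin[OF S] by auto
qed

lemma upper_gradient_0: "upper_gradient M d (\<lambda>x. 0) (\<lambda>x. 0)"
  by (simp add: upper_gradient_def zero_ereal_def)

text \<open>Extracts an almost optimal upper gradient from \<open>N1norm\<close>; the strict bound
  makes \<open>a\<close> finite, so it can be moved to the other side.\<close>

lemma sum_lessE_INF:
  fixes a b :: ennreal
  assumes "a + (INF x\<in>S. f x) < b"
  obtains x where "x \<in> S" "a + f x < b"
proof -
  have "a < top"
    using assms by (cases "a = top") (auto simp: less_top)
  then have "(INF x\<in>S. f x) < b - a"
    using assms by (simp add: less_diff_eq_ennreal add.commute)
  then obtain x where "x \<in> S" "f x < b - a"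
    by (auto simp: INF_less_iff)
  then show thesis
    using that \<open>a < top\<close> by (simp add: less_diff_eq_ennreal add.commute)
qed

section \<open>Capacity and quasicontinuity\<close>

locale function_lattice_space =
  fixes M :: "'a set" and d mu nX and c :: real
  assumes standing: "standing M d mu" and lattice: "qBFL mu nX c"
begin

sublocale Metric_space M d
  using standing by (simp add: standing_def)

abbreviation "cap \<equiv> capX M d mu nX"
abbreviation "N1 \<equiv> N1X M d mu nX"
abbreviation "ug \<equiv> upper_gradient M d"

lemma c_ge_1: "1 \<le> c" and c_pos: "0 < c" and c_nonneg: "0 \<le> c"
  using lattice by (auto simp: qBFL_def)

lemma space_mu [simp]: "space mu = M"
  using standing by (simp add: standing_def)

lemma mtop_eq [simp]: "mtop M d = mtopology"
  by (simp add: mtop_def)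

lemma norm_eq_0: "u \<in> borel_measurable mu \<Longrightarrow> nX u = 0 \<longleftrightarrow> (AE x in mu. u x = 0)"
  and norm_cmult: "u \<in> borel_measurable mu \<Longrightarrow> nX (\<lambda>x. ereal a * u x) = ennreal \<bar>a\<bar> * nX u"
  and norm_add: "u \<in> borel_measurable mu \<Longrightarrow> v \<in> borel_measurable mu \<Longrightarrow>
        nX (\<lambda>x. u x + v x) \<le> ennreal c * (nX u + nX v)"
  and norm_mono: "u \<in> borel_measurable mu \<Longrightarrow> v \<in> borel_measurable mu \<Longrightarrow>
        (AE x in mu. \<bar>u x\<bar> \<le> \<bar>v x\<bar>) \<Longrightarrow> nX u \<le> nX v"
  and norm_suminf: "(\<And>n. us n \<in> borel_measurable mu) \<Longrightarrow> (\<And>n. AE x in mu. us n x \<ge> 0) \<Longrightarrow>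
        nX (\<lambda>x. \<Sum>n. us n x) \<le> (\<Sum>n. ennreal (c ^ Suc n) * nX (us n))"
  and norm_continuous: "u \<in> lattice_X mu nX \<Longrightarrow> (\<And>n. us n \<in> lattice_X mu nX) \<Longrightarrow>
        (\<lambda>n. nX (\<lambda>x. us n x - u x)) \<longlonglongrightarrow> 0 \<Longrightarrow> (\<lambda>n. nX (us n)) \<longlonglongrightarrow> nX u"
  using lattice unfolding qBFL_def by - (elim conjE; simp; fail)+

lemma norm_zero [simp]: "nX (\<lambda>x. 0) = 0"
  using norm_eq_0[of "\<lambda>x. 0"] by simp

text \<open>Upper gradients are Borel while the lattice axioms concern \<open>mu\<close>-measurable
  functions; the inclusion of sigma-algebras in \<open>standing\<close> connects the two.\<close>

lemma upper_gradient_measurable: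
  assumes "ug g u"
  shows "(\<lambda>x. enn2ereal (g x)) \<in> borel_measurable mu"
proof -
  have "{U. openin (mtop M d) U} \<subseteq> Pow M"
    using openin_mtopology by auto
  then have "space (borel_mspace M d) = M"
    unfolding borel_mspace_def by (rule space_measure_of)
  then have "borel_measurable (borel_mspace M d) \<subseteq> (borel_measurable mu :: ('a \<Rightarrow> ennreal) set)"
    using standing by (intro measurable_mono) (auto simp: standing_def)
  then have "g \<in> borel_measurable mu"
    using assms by (auto simp: upper_gradient_def)
  then show ?thesis by measurable
qed

section \<open>Capacity in terms of test functions and their upper gradients\<close>

text \<open>If the right-hand side is infinite there is nothing to prove; otherwise \<open>u\<close>
  lies in \<open>N1\<close> and competes in the infimum.\<close>

lemma capX_le:
  assumes "u \<in> borel_measurable mu" "\<And>x. x \<in> E \<Longrightarrow> 1 \<le> u x" "ug g u"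
  shows "cap E \<le> nX u + nX (\<lambda>x. enn2ereal (g x))"
proof (cases "nX u + nX (\<lambda>x. enn2ereal (g x)) = \<infinity>")
  case False
  have *: "N1norm M d nX u \<le> nX u + nX (\<lambda>x. enn2ereal (g x))"
    unfolding N1norm_def using assms(3) by (intro add_left_mono INF_lower) auto
  have less: "nX u + nX (\<lambda>x. enn2ereal (g x)) < \<infinity>"
    using False by (simp add: less_top)
  then have "nX u < \<infinity>"
    by simp
  with assms(1) le_less_trans[OF * less] have "u \<in> N1"
    by (simp add: N1X_def lattice_X_def)
  then have "cap E \<le> N1norm M d nX u"
    unfolding capX_def using assms(2) by (intro INF_lower) auto
  with * show ?thesis by (rule order_trans[rotated])
next
  case True
  show ?thesis
    unfolding True by simp
qed

lemma N1norm_lessE: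
  assumes "N1norm M d nX u < a"
  obtains g where "ug g u" "nX u + nX (\<lambda>x. enn2ereal (g x)) < a"
  using assms unfolding N1norm_def by (elim sum_lessE_INF) auto

lemma norm_truncate_le:
  assumes "u \<in> borel_measurable mu" "0 \<le> k"
  shows "nX (\<lambda>x. min 1 (ereal k * \<bar>u x\<bar>)) \<le> ennreal k * nX u"
proof -
  have "\<bar>min 1 (ereal k * \<bar>r\<bar>)\<bar> \<le> \<bar>ereal k * r\<bar>" for r :: ereal
    using assms(2) by (cases r) (auto simp: min_def abs_mult)
  then have "nX (\<lambda>x. min 1 (ereal k * \<bar>u x\<bar>)) \<le> nX (\<lambda>x. ereal k * u x)"
    using assms by (intro norm_mono) auto
  also have "\<dots> = ennreal k * nX u"
    using assms norm_cmult by simp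
  finally show ?thesis .
qed

text \<open>Truncating with \<open>k = 1\<close> brings an almost optimal function into
  \<open>[0,1]\<close>, as \<open>upper_gradient_SUP\<close> demands, without increasing its norm
  and with the same upper gradient.\<close>

lemma capX_lessE:
  assumes "cap E < a"
  obtains u g where "u \<in> borel_measurable mu" "\<And>x. 0 \<le> u x \<and> u x \<le> 1"
    "\<And>x. x \<in> E \<Longrightarrow> 1 \<le> u x" "ug g u" "nX u + nX (\<lambda>x. enn2ereal (g x)) < a"
proof -
  obtain v where v: "v \<in> N1" "\<And>x. x \<in> E \<Longrightarrow> 1 \<le> v x" "N1norm M d nX v < a"
    using assms unfolding capX_def by (auto simp: INF_less_iff)
  then obtain g where g: "ug g v" "nX v + nX (\<lambda>x. enn2ereal (g x)) < a"
    by (elim N1norm_lessE)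
  have m: "v \<in> borel_measurable mu"
    using v(1) by (simp add: N1X_def lattice_X_def)
  show thesis
  proof
    show "(\<lambda>x. min 1 (ereal 1 * \<bar>v x\<bar>)) \<in> borel_measurable mu"
      using m by auto
    show "ug (\<lambda>x. ennreal 1 * g x) (\<lambda>x. min 1 (ereal 1 * \<bar>v x\<bar>))"
      using g(1) by (rule upper_gradient_truncate) simp
    show "1 \<le> min 1 (ereal 1 * \<bar>v x\<bar>)" if "x \<in> E" for x
      using v(2)[OF that] by (cases "v x") auto
    have "nX (\<lambda>x. min 1 (ereal 1 * \<bar>v x\<bar>)) + nX (\<lambda>x. enn2ereal (ennreal 1 * g x))
        \<le> ennreal 1 * nX v + nX (\<lambda>x. enn2ereal (ennreal 1 * g x))"
      by (intro add_right_mono norm_truncate_le m) simp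
    then show "nX (\<lambda>x. min 1 (ereal 1 * \<bar>v x\<bar>)) + nX (\<lambda>x. enn2ereal (ennreal 1 * g x)) < a"
      using g(2) unfolding ennreal_1 mult_1 by (rule le_less_trans)
    show "0 \<le> min 1 (ereal 1 * \<bar>v x\<bar>) \<and> min 1 (ereal 1 * \<bar>v x\<bar>) \<le> 1" for x
      by (cases "v x") auto
  qed
qed

lemma capX_mono: "E \<subseteq> F \<Longrightarrow> cap E \<le> cap F"
  unfolding capX_def by (intro INF_superset_mono) auto

lemma capX_empty [simp]: "cap {} = 0"
  using capX_le[OF _ _ upper_gradient_0, of "{}"] by (simp add: zero_ennreal.rep_eq)

section \<open>Countable subadditivity with weights, and Chebyshev's inequality\<close>

text \<open>A supremum of nonnegative functions is dominated by their sum, to which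
  \<open>norm_suminf\<close> applies.\<close>

lemma norm_SUP_le:
  assumes "\<And>j::nat. u j \<in> borel_measurable mu" "\<And>j x. 0 \<le> u j x"
  shows "nX (\<lambda>x. SUP j. u j x) \<le> (\<Sum>j. ennreal (c ^ Suc j) * nX (u j))"
proof -
  have "nX (\<lambda>x. SUP j. u j x) \<le> nX (\<lambda>x. \<Sum>j. u j x)"
  proof (intro norm_mono AE_I2)
    fix x
    have "u j x \<le> (\<Sum>j. u j x)" for j
      using sum_le_suminf[of "\<lambda>j. u j x" "{j}"] assms(2) summable_ereal_pos by simp
    then have "0 \<le> (SUP j. u j x)" "(SUP j. u j x) \<le> (\<Sum>j. u j x)"
      using assms(2) by (auto intro!: SUP_least intro: SUP_upper2)
    then show "\<bar>SUP j. u j x\<bar> \<le> \<bar>\<Sum>j. u j x\<bar>"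
      by simp
  qed (use assms(1) in auto)
  also have "\<dots> \<le> (\<Sum>j. ennreal (c ^ Suc j) * nX (u j))"
    using assms by (intro norm_suminf) auto
  finally show ?thesis .
qed

text \<open>The supremum of almost optimal functions for the \<open>E j\<close> is admissible for
  the union, and the supremum of their upper gradients is an upper gradient of it.\<close>

lemma capX_UN_le:
  fixes E :: "nat \<Rightarrow> 'a set"
  assumes "\<And>j. cap (E j) < \<delta> j"
  shows "cap (\<Union>j. E j) \<le> (\<Sum>j. ennreal (c ^ Suc j) * \<delta> j)"
proof -
  have "\<exists>u g. u \<in> borel_measurable mu \<and> (\<forall>x. 0 \<le> u x \<and> u x \<le> 1) \<and> (\<forall>x\<in>E j. 1 \<le> u x) \<and>
      ug g u \<and> nX u + nX (\<lambda>x. enn2ereal (g x)) < \<delta> j" for j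
    using assms[of j] by (elim capX_lessE) blast
  then obtain u g where u: "\<And>j. u j \<in> borel_measurable mu"
    "\<And>j x. 0 \<le> u j x \<and> u j x \<le> 1" "\<And>j x. x \<in> E j \<Longrightarrow> 1 \<le> u j x"
    and g: "\<And>j. ug (g j) (u j)" and less: "\<And>j. nX (u j) + nX (\<lambda>x. enn2ereal (g j x)) < \<delta> j"
    by metis
  have "cap (\<Union>j. E j) \<le> nX (\<lambda>x. SUP j. u j x) + nX (\<lambda>x. enn2ereal (SUP j. g j x))"
  proof (rule capX_le)
    show "ug (\<lambda>x. SUP j. g j x) (\<lambda>x. SUP j. u j x)"
      using g u(2) by (rule upper_gradient_SUP)
    show "1 \<le> (SUP j. u j x)" if "x \<in> (\<Union>j. E j)" for x
      using that u(3) by (auto intro: SUP_upper2)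
  qed (use u(1) in auto)
  also have "\<dots> \<le> (\<Sum>j. ennreal (c ^ Suc j) * nX (u j)) +
      (\<Sum>j. ennreal (c ^ Suc j) * nX (\<lambda>x. enn2ereal (g j x)))"
    unfolding enn2ereal_SUP[OF UNIV_not_empty]
    using u upper_gradient_measurable[OF g] by (intro add_mono norm_SUP_le) auto
  also have "\<dots> = (\<Sum>j. ennreal (c ^ Suc j) * (nX (u j) + nX (\<lambda>x. enn2ereal (g j x))))"
    by (simp add: suminf_add distrib_left)
  also have "\<dots> \<le> (\<Sum>j. ennreal (c ^ Suc j) * \<delta> j)"
    using less by (intro suminf_le mult_left_mono) (auto intro: less_imp_le)
  finally show ?thesis .
qed

text \<open>The weight \<open>c ^ Suc j\<close> cancels against the bound, leaving
  \<open>e * (1 / 2) ^ Suc j\<close>, which sums to \<open>e\<close>.\<close>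

lemma capX_UN_small:
  fixes E :: "nat \<Rightarrow> 'a set"
  assumes "\<And>j. cap (E j) < ennreal (e / (2 * c) ^ Suc j)" "0 \<le> e"
  shows "cap (\<Union>j. E j) \<le> ennreal e"
proof -
  have eq: "ennreal (c ^ Suc j) * ennreal (e / (2 * c) ^ Suc j) = ennreal (e * (1 / 2) ^ Suc j)" for j
    using c_pos assms(2) by (subst ennreal_mult'[symmetric]) (auto simp: power_mult_distrib field_simps)
  have "cap (\<Union>j. E j) \<le> (\<Sum>j. ennreal (c ^ Suc j) * ennreal (e / (2 * c) ^ Suc j))"
    using assms(1) by (rule capX_UN_le)
  also have "\<dots> = (\<Sum>j. ennreal (e * (1 / 2) ^ Suc j))"
    by (simp only: eq)
  also have "\<dots> = ennreal e"
    using sums_mult[OF power_half_series, of e] assms(2) by (intro suminf_ennreal_eq) auto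
  finally show ?thesis .
qed

text \<open>The truncation of \<open>k * |u|\<close> at 1 is admissible for the superlevel set, and
  the norms of the function and of its gradient grow at most by the factor \<open>k\<close>.\<close>

lemma chebyshev_capX:
  assumes u: "u \<in> borel_measurable mu" and a: "N1norm M d nX u < a" and k: "0 < k"
  shows "cap {x \<in> M. ereal (1 / k) < \<bar>u x\<bar>} < ennreal k * a"
proof -
  obtain g where g: "ug g u" "nX u + nX (\<lambda>x. enn2ereal (g x)) < a"
    using a by (elim N1norm_lessE)
  have "1 \<le> min 1 (ereal k * \<bar>r\<bar>)" if "ereal (1 / k) < \<bar>r\<bar>" for r :: ereal
    using that k by (cases r) (auto simp: field_simps)
  then have "cap {x \<in> M. ereal (1 / k) < \<bar>u x\<bar>} \<le>
      nX (\<lambda>x. min 1 (ereal k * \<bar>u x\<bar>)) + nX (\<lambda>x. enn2ereal (ennreal k * g x))"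
    using u by (intro capX_le upper_gradient_truncate g k) auto
  also have "\<dots> \<le> ennreal k * nX u + ennreal k * nX (\<lambda>x. enn2ereal (g x))"
    using norm_truncate_le[OF u, of k] norm_cmult[OF upper_gradient_measurable[OF g(1)], of k] k
    by (simp add: enn2ereal_ennreal_mult add_right_mono)
  also have "\<dots> = ennreal k * (nX u + nX (\<lambda>x. enn2ereal (g x)))"
    by (simp add: distrib_left)
  also have "\<dots> < ennreal k * a"
    using g(2) k by (intro ennreal_mult_strict_left_mono) auto
  finally show ?thesis .
qed

section \<open>Approximation by continuous functions; (G) and (F)\<close>

lemma continuous_approximation:
  assumes dense: "cont_dense M d mu nX" and u: "u \<in> N1"
  obtains w :: "nat \<Rightarrow> 'a \<Rightarrow> real" where "\<And>j. continuous_map mtopology euclideanreal (w j)"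
    "\<And>k. cap (\<Union>i. {x \<in> M. ereal ((1 / 2) ^ (k + i)) < \<bar>u x - ereal (w (k + i) x)\<bar>})
          \<le> ennreal ((1 / 2) ^ k)"
proof -
  \<comment> \<open>Chebyshev's inequality at level \<open>(1 / 2) ^ j\<close> costs a factor
    \<open>2 ^ j\<close>; after it, \<open>1 / (2 * c) ^ Suc j\<close> remains for
    \<open>cap (E j)\<close>.\<close>
  define a where "a j = ennreal ((1 / 2) ^ j / (2 * c) ^ Suc j)" for j
  have "0 < a j" for j
    using c_pos by (simp add: a_def)
  then have "\<exists>v\<in>N1. cont_off M d {} v \<and> N1norm M d nX (\<lambda>x. u x - v x) < a j" for j
    using dense u unfolding cont_dense_def by blast
  then obtain v where v: "\<And>j. v j \<in> N1" "\<And>j. cont_off M d {} (v j)"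
    "\<And>j. N1norm M d nX (\<lambda>x. u x - v j x) < a j"
    by metis
  \<comment> \<open>\<open>cont_off\<close> gives finiteness on \<open>M\<close> only, so
    \<open>w j\<close> and \<open>v j\<close> are compared only there.\<close>
  define w where "w j x = real_of_ereal (v j x)" for j x
  have w: "ereal (w j x) = v j x" if "x \<in> M" for j x
    using v(2)[of j] that by (auto simp: cont_off_def w_def ereal_real)
  have meas: "(\<lambda>x. u x - v j x) \<in> borel_measurable mu" for j
    using u v(1)[of j] by (auto simp: N1X_def lattice_X_def)
  define E where "E j = {x \<in> M. ereal ((1 / 2) ^ j) < \<bar>u x - ereal (w j x)\<bar>}" for j
  have cap_E: "cap (E j) < ennreal (1 / (2 * c) ^ Suc j)" for j
  proof -
    have "E j = {x \<in> M. ereal (1 / 2 ^ j) < \<bar>u x - v j x\<bar>}"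
      using w by (auto simp: E_def power_divide)
    then have "cap (E j) < ennreal (2 ^ j) * a j"
      using chebyshev_capX[OF meas v(3), of "2 ^ j" j] by simp
    also have "\<dots> = ennreal (1 / (2 * c) ^ Suc j)"
      unfolding a_def using c_pos by (subst ennreal_mult'[symmetric]) (auto simp: power_divide)
    finally show ?thesis .
  qed
  have approx: "cap (\<Union>i. E (k + i)) \<le> ennreal ((1 / 2) ^ k)" for k
  proof (rule capX_UN_small)
    fix i
    \<comment> \<open>The index shift by \<open>k\<close> gains a factor
      \<open>(2 * c) ^ k >= 2 ^ k\<close>, which makes the whole tail fit into
      \<open>(1 / 2) ^ k\<close>.\<close>
    have "(2 * c) ^ k * (2 * c) ^ Suc i \<ge> 2 ^ k * (2 * c) ^ Suc i"
      using c_ge_1 by (intro mult_right_mono power_mono) auto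
    then have "1 / (2 * c) ^ Suc (k + i) \<le> 1 / (2 ^ k * (2 * c) ^ Suc i)"
      using c_pos by (intro divide_left_mono) (auto simp: power_add mult_ac)
    also have "\<dots> = (1 / 2) ^ k / (2 * c) ^ Suc i"
      by (simp add: power_divide)
    finally show "cap (E (k + i)) < ennreal ((1 / 2) ^ k / (2 * c) ^ Suc i)"
      by (rule less_le_trans[OF cap_E ennreal_leI])
  qed simp
  have "continuous_map mtopology euclideanreal (w j)" for j
    using v(2)[of j] subtopology_topspace[of mtopology] by (simp add: cont_off_def w_def[abs_def])
  then show thesis
    using approx unfolding E_def by (rule that)
qed

text \<open>The uniform limit theorem on the subspace \<open>M - E\<close>; a real distance bound to
  a real function also excludes infinite values of \<open>u\<close>.\<close>

lemma cont_off_uniform_limit: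
  fixes w :: "nat \<Rightarrow> 'a \<Rightarrow> real"
  assumes w: "\<And>i. continuous_map mtopology euclideanreal (w i)" and e: "e \<longlonglongrightarrow> 0"
    and le: "\<And>i x. x \<in> M - E \<Longrightarrow> \<bar>u x - ereal (w i x)\<bar> \<le> ereal (e i)"
  shows "cont_off M d E u"
  unfolding cont_off_def
proof (intro conjI ballI)
  show fin: "\<bar>u x\<bar> \<noteq> \<infinity>" if "x \<in> M - E" for x
    using le[OF that, of 0] by (cases "u x") auto
  let ?X = "subtopology (mtop M d) (M - E)"
  have "continuous_map ?X Met_TC.mtopology (\<lambda>x. real_of_ereal (u x))"
  proof (rule Met_TC.continuous_map_uniform_limit)
    show "\<forall>\<^sub>F i in sequentially. continuous_map ?X Met_TC.mtopology (w i)"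
      using w by (simp add: continuous_map_from_subtopology)
    show "\<forall>\<^sub>F i in sequentially. \<forall>x\<in>topspace ?X. real_of_ereal (u x) \<in> UNIV
        \<and> dist (w i x) (real_of_ereal (u x)) < \<epsilon>" if "0 < \<epsilon>" for \<epsilon>
      using order_tendstoD(2)[OF e that]
    proof eventually_elim
      case (elim i)
      have "\<bar>real_of_ereal (u x) - w i x\<bar> \<le> e i" if "x \<in> M - E" for x
        using le[OF that, of i] fin[OF that] by (cases "u x") auto
      with elim show ?case
        by (auto simp: dist_real_def abs_minus_commute intro: le_less_trans)
    qed
  qed simp
  then show "continuous_map ?X euclideanreal (\<lambda>x. real_of_ereal (u x))"
    by simp
qed

lemma cont_off_cong_superset:
  assumes "cont_off M d E v" "E \<subseteq> F" "\<And>x. x \<in> M - F \<Longrightarrow> u x = v x"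
  shows "cont_off M d F u"
proof -
  have "continuous_map (subtopology mtopology (M - F)) euclideanreal (\<lambda>x. real_of_ereal (v x))"
    using assms(1,2) by (auto simp: cont_off_def intro: continuous_map_from_subtopology_mono)
  then have "continuous_map (subtopology mtopology (M - F)) euclideanreal (\<lambda>x. real_of_ereal (u x))"
    by (rule continuous_map_eq) (simp add: assms(3))
  moreover have "\<bar>u x\<bar> \<noteq> \<infinity>" if "x \<in> M - F" for x
    using assms(1,2) assms(3)[OF that] that unfolding cont_off_def by (metis DiffE DiffI subsetD)
  ultimately show ?thesis
    by (simp add: cont_off_def)
qed

text \<open>Off the tail union \<open>E\<close> the functions \<open>w (k + i)\<close> converge to
  \<open>u\<close> uniformly. \<open>E\<close> is defined through \<open>u\<close> itself, so it
  need not be open.\<close>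

lemma cont_dense_imp_propG:
  assumes dense: "cont_dense M d mu nX"
  shows "propG M d mu nX"
  unfolding propG_def weakly_qc_def
proof (intro ballI allI impI)
  fix u and \<epsilon> :: ennreal
  assume "u \<in> N1" "0 < \<epsilon>"
  obtain w where w: "\<And>j. continuous_map mtopology euclideanreal (w j)"
    "\<And>k. cap (\<Union>i. {x \<in> M. ereal ((1 / 2) ^ (k + i)) < \<bar>u x - ereal (w (k + i) x)\<bar>})
          \<le> ennreal ((1 / 2) ^ k)"
    by (rule continuous_approximation[OF dense \<open>u \<in> N1\<close>]) blast
  obtain k where k: "ennreal ((1 / 2) ^ k) < \<epsilon>"
    using ex_half_power_less[OF \<open>0 < \<epsilon>\<close>] by blast
  define E where "E = (\<Union>i. {x \<in> M. ereal ((1 / 2) ^ (k + i)) < \<bar>u x - ereal (w (k + i) x)\<bar>})"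
  have "cont_off M d E u"
  proof (rule cont_off_uniform_limit)
    show "(\<lambda>i. 1 * (1 / 2) ^ (k + i)) \<longlonglongrightarrow> (0::real)"
      by (rule half_power_offset_tendsto)
    show "\<bar>u x - ereal (w (k + i) x)\<bar> \<le> ereal (1 * (1 / 2) ^ (k + i))" if "x \<in> M - E" for i x
      using that by (auto simp: E_def not_less)
  qed (rule w(1))
  moreover have "cap E < \<epsilon>"
    using w(2)[of k] k unfolding E_def by (rule le_less_trans)
  ultimately show "\<exists>E\<subseteq>M. cap E < \<epsilon> \<and> cont_off M d E u"
    by (intro exI[of _ E]) (auto simp: E_def)
qed

text \<open>Comparing consecutive \<open>w j\<close> instead of \<open>w j\<close> with
  \<open>u\<close> gives exceptional sets defined by continuous functions, hence open.\<close>

lemma cont_dense_imp_propF: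
  assumes dense: "cont_dense M d mu nX"
  shows "propF M d mu nX"
  unfolding propF_def
proof
  fix u assume "u \<in> N1"
  obtain w where w: "\<And>j. continuous_map mtopology euclideanreal (w j)"
    "\<And>k. cap (\<Union>i. {x \<in> M. ereal ((1 / 2) ^ (k + i)) < \<bar>u x - ereal (w (k + i) x)\<bar>})
          \<le> ennreal ((1 / 2) ^ k)"
    by (rule continuous_approximation[OF dense \<open>u \<in> N1\<close>]) blast
  define E where "E j = {x \<in> M. ereal ((1 / 2) ^ j) < \<bar>u x - ereal (w j x)\<bar>}" for j
  \<comment> \<open>The threshold is at least \<open>(1 / 2) ^ j + (1 / 2) ^ Suc j\<close>, so the
    triangle inequality through \<open>u x\<close> gives \<open>H_sub\<close>.\<close>
  define H where "H j = {x \<in> M. 2 * (1 / 2) ^ j < \<bar>w j x - w (Suc j) x\<bar>}" for j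
  have open_H: "openin mtopology (H j)" for j
    using openin_continuous_map_preimage[of mtopology euclideanreal
        "\<lambda>x. \<bar>w j x - w (Suc j) x\<bar>" "{2 * (1 / 2) ^ j <..}"] w(1)
    by (simp add: H_def continuous_map_real_abs continuous_map_diff)
  have H_sub: "H j \<subseteq> E j \<union> E (Suc j)" for j
  proof
    fix x assume x: "x \<in> H j"
    show "x \<in> E j \<union> E (Suc j)"
    proof (rule ccontr)
      assume "x \<notin> E j \<union> E (Suc j)"
      with x have *: "\<bar>u x - ereal (w j x)\<bar> \<le> ereal ((1 / 2) ^ j)"
        "\<bar>u x - ereal (w (Suc j) x)\<bar> \<le> ereal ((1 / 2) ^ Suc j)"
        by (auto simp: E_def H_def not_less)
      then obtain a where "u x = ereal a"
        by (cases "u x") auto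
      with * have "\<bar>a - w j x\<bar> \<le> (1 / 2) ^ j" "\<bar>a - w (Suc j) x\<bar> \<le> (1 / 2) ^ Suc j"
        by (simp_all del: power_Suc)
      then have "\<bar>w j x - w (Suc j) x\<bar> \<le> (1 / 2) ^ j + (1 / 2) ^ Suc j"
        by linarith
      also have "\<dots> \<le> 2 * (1 / 2) ^ j"
        by simp
      finally show False
        using x by (simp add: H_def)
    qed
  qed
  \<comment> \<open>\<open>lim\<close> is unspecified at divergent sequences; points of
    \<open>M\<close> where this happens lie in every set \<open>G\<close> constructed below.\<close>
  define v where "v x = ereal (lim (\<lambda>j. w j x))" for x
  have "quasicont M d mu nX v"
    unfolding quasicont_def
  proof (intro allI impI)
    fix \<epsilon> :: ennreal assume "0 < \<epsilon>"
    then obtain k where k: "ennreal ((1 / 2) ^ k) < \<epsilon>"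
      using ex_half_power_less by blast
    define G where "G = (\<Union>i. H (k + i))"
    have "G \<subseteq> (\<Union>i. E (k + i))"
      using H_sub unfolding G_def by (fastforce intro: exI[of _ "Suc _"])
    then have "cap G \<le> cap (\<Union>i. E (k + i))"
      by (rule capX_mono)
    also have "\<dots> \<le> ennreal ((1 / 2) ^ k)"
      using w(2)[of k] by (simp add: E_def)
    finally have "cap G < \<epsilon>"
      using k by simp
    moreover have "cont_off M d G v"
    proof (rule cont_off_uniform_limit)
      \<comment> \<open>The 4 is the factor 2 of \<open>geometric_Cauchy_limit\<close> times the 2
        in the threshold of \<open>H\<close>.\<close>
      show "(\<lambda>i. 4 * (1 / 2) ^ (k + i)) \<longlonglongrightarrow> (0::real)"
        by (rule half_power_offset_tendsto)
      show "\<bar>v x - ereal (w (k + i) x)\<bar> \<le> ereal (4 * (1 / 2) ^ (k + i))" if x: "x \<in> M - G" for i x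
      proof -
        have "\<bar>w (k + i) x - w (k + Suc i) x\<bar> \<le> 2 * (1 / 2) ^ k * (1 / 2) ^ i" for i
          using x by (auto simp: G_def H_def not_less power_add mult.assoc)
        note * = geometric_Cauchy_limit[of "\<lambda>i. w (k + i) x", OF this]
        have "(\<lambda>i. w (k + i) x) \<longlonglongrightarrow> lim (\<lambda>i. w (k + i) x)"
          using *(1) by (simp add: convergent_LIMSEQ_iff)
        then have "(\<lambda>i. w i x) \<longlonglongrightarrow> lim (\<lambda>i. w (k + i) x)"
          by (intro LIMSEQ_offset[of "\<lambda>i. w i x" k]) (simp add: add.commute)
        then have "lim (\<lambda>i. w i x) = lim (\<lambda>i. w (k + i) x)"
          by (rule limI)
        then show ?thesis
          using *(2)[of i] by (simp add: v_def power_add)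
      qed
    qed (rule w(1))
    ultimately show "\<exists>E. openin (mtop M d) E \<and> cap E < \<epsilon> \<and> cont_off M d E v"
      using open_H by (intro exI[of _ G]) (auto simp: G_def)
  qed
  \<comment> \<open>The set where \<open>v\<close> and \<open>u\<close> differ lies in every tail
    union of the \<open>E j\<close>, so its capacity is at most \<open>(1 / 2) ^ k\<close> for every
    \<open>k\<close>.\<close>
  moreover have "cap {x \<in> M. v x \<noteq> u x} = 0"
  proof (rule ccontr)
    assume "cap {x \<in> M. v x \<noteq> u x} \<noteq> 0"
    then obtain k where k: "ennreal ((1 / 2) ^ k) < cap {x \<in> M. v x \<noteq> u x}"
      using ex_half_power_less[of "cap {x \<in> M. v x \<noteq> u x}"] by (auto simp: zero_less_iff_neq_zero)
    have "v x = u x" if x: "x \<in> M" "x \<notin> (\<Union>i. E (k + i))" for x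
    proof -
      have *: "\<bar>u x - ereal (w (k + i) x)\<bar> \<le> ereal ((1 / 2) ^ (k + i))" for i
        using x by (auto simp: E_def not_less)
      then obtain r where r: "u x = ereal r"
        using *[of 0] by (cases "u x") auto
      have "(\<lambda>i. w (k + i) x) \<longlonglongrightarrow> r"
      proof (rule LIM_zero_cancel, rule Lim_null_comparison)
        show "(\<lambda>i. 1 * (1 / 2) ^ (k + i)) \<longlonglongrightarrow> (0::real)"
          by (rule half_power_offset_tendsto)
        show "\<forall>\<^sub>F i in sequentially. norm (w (k + i) x - r) \<le> 1 * (1 / 2) ^ (k + i)"
          using * r by (simp add: abs_minus_commute)
      qed
      then have "(\<lambda>i. w i x) \<longlonglongrightarrow> r"
        by (intro LIMSEQ_offset[of "\<lambda>i. w i x" k]) (simp add: add.commute)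
      then show ?thesis
        using r by (simp add: v_def limI)
    qed
    then have "cap {x \<in> M. v x \<noteq> u x} \<le> cap (\<Union>i. E (k + i))"
      by (intro capX_mono) blast
    also have "\<dots> \<le> ennreal ((1 / 2) ^ k)"
      using w(2)[of k] by (simp add: E_def)
    finally show False
      using k by simp
  qed
  ultimately show "\<exists>v. quasicont M d mu nX v \<and> cap {x \<in> M. v x \<noteq> u x} = 0"
    by blast
qed

section \<open>From (E) to (A)\<close>

lemma propE_imp_propA:
  assumes "cont_dense M d mu nX" "propE M d mu nX"
  shows "propA M d mu nX"
  unfolding propA_def quasicont_def
proof (intro ballI allI impI)
  fix u and \<epsilon> :: ennreal
  assume "u \<in> N1" and \<epsilon>: "0 < \<epsilon>"
  then obtain v where v: "quasicont M d mu nX v" "cap {x \<in> M. v x \<noteq> u x} = 0"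
    using cont_dense_imp_propF[OF assms(1)] by (auto simp: propF_def)
  obtain k where k: "ennreal ((1 / 2) ^ k) < \<epsilon>"
    using ex_half_power_less[OF \<epsilon>] by blast
  define \<delta> where "\<delta> j = ennreal ((1 / 2) ^ k / (2 * c) ^ Suc j)" for j
  have \<delta>: "0 < \<delta> j" for j
    using c_pos by (simp add: \<delta>_def)
  obtain G where G: "openin mtopology G" "cap G < \<delta> 0" "cont_off M d G v"
    using v(1) \<delta>[of 0] by (auto simp: quasicont_def)
  have "\<forall>E\<subseteq>M. cap E = 0 \<longrightarrow> (\<forall>\<epsilon>>0. \<exists>G. openin mtopology G \<and> E \<subseteq> G \<and> cap G < \<epsilon>)"
    using assms(2) by (simp add: propE_def)
  then obtain H where H: "openin mtopology H" "{x \<in> M. v x \<noteq> u x} \<subseteq> H" "cap H < \<delta> 1"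
    using v(2) \<delta>[of 1] by (metis (no_types, lifting) mem_Collect_eq subsetI)
  \<comment> \<open>Padding with empty sets, of capacity 0, turns the two sets into a sequence for
    \<open>capX_UN_small\<close>.\<close>
  define S where "S j = (if j = 0 then G else if j = 1 then H else {})" for j :: nat
  have "(\<Union>j. S j) = G \<union> H"
    by (auto simp: S_def split: if_splits intro: exI[of _ 0] exI[of _ "1::nat"])
  moreover have "cap (\<Union>j. S j) \<le> ennreal ((1 / 2) ^ k)"
    using G(2) H(3) \<delta> by (intro capX_UN_small) (auto simp: S_def \<delta>_def)
  ultimately have "cap (G \<union> H) < \<epsilon>"
    using k by simp
  moreover have "cont_off M d (G \<union> H) u"
    using H(2) by (intro cont_off_cong_superset[OF G(3)]) auto
  ultimately show "\<exists>E. openin (mtop M d) E \<and> cap E < \<epsilon> \<and> cont_off M d E u"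
    using G(1) H(1) by (intro exI[of _ "G \<union> H"]) auto
qed

section \<open>From (A) to (B)\<close>

text \<open>Every multiple of the indicator \<open>h\<close> of the set of infinite values is
  dominated by \<open>|u|\<close>; by homogeneity \<open>n * nX h <= nX u\<close> for all
  \<open>n\<close>, so \<open>nX h = 0\<close>.\<close>

lemma norm_finite_AE:
  assumes u: "u \<in> borel_measurable mu" and fin: "nX u < \<infinity>"
  shows "AE x in mu. \<bar>u x\<bar> \<noteq> \<infinity>"
proof -
  define h :: "'a \<Rightarrow> ereal" where "h x = (if \<bar>u x\<bar> = \<infinity> then 1 else 0)" for x
  have h: "h \<in> borel_measurable mu"
    unfolding h_def using u by measurable
  obtain r where r: "0 \<le> r" "nX u = ennreal r"
    using fin by (cases "nX u") auto
  have le: "ennreal (real n) * nX h \<le> ennreal r" for n :: nat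
  proof -
    have "ennreal (real n) * nX h = nX (\<lambda>x. ereal (real n) * h x)"
      using norm_cmult[OF h, of "real n"] by simp
    also have "\<dots> \<le> nX u"
      using u h by (intro norm_mono AE_I2) (auto simp: h_def)
    finally show ?thesis
      using r by simp
  qed
  obtain s where s: "0 \<le> s" "nX h = ennreal s"
    using le[of 1] by (cases "nX h") (auto simp: top_unique)
  have "real n * s \<le> r" for n
    using le[of n] r s by (simp add: ennreal_mult'[symmetric] ennreal_le_iff)
  then have "s = 0"
    using s(1) by (metis less_eq_real_def linorder_not_le reals_Archimedean3)
  then have "AE x in mu. h x = 0"
    using norm_eq_0[OF h] s(2) by simp
  then show ?thesis
    by eventually_elim (simp add: h_def split: if_splits)
qed

text \<open>The only use of the continuity of the quasinorm; it is what gives (B) with constant 1.\<close>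

lemma norm_perturbation_tendsto:
  fixes e :: "nat \<Rightarrow> real"
  assumes u: "u \<in> borel_measurable mu" "\<And>x. 0 \<le> u x" "nX u < \<infinity>"
    and f: "\<And>n. f n \<in> borel_measurable mu" and w: "\<And>n. w n \<in> borel_measurable mu"
    and w_nonneg: "\<And>n x. 0 \<le> w n x" and w_le: "\<And>n. nX (w n) \<le> ennreal (e n)"
    and e: "e \<longlonglongrightarrow> 0" "\<And>n. 0 \<le> e n"
    and lower: "\<And>n x. u x \<le> f n x" and upper: "\<And>n x. f n x \<le> ereal (1 + e n) * u x + w n x"
  shows "(\<lambda>n. nX (f n)) \<longlonglongrightarrow> nX u"
proof (rule norm_continuous)
  obtain r where r: "0 \<le> r" "nX u = ennreal r"
    using u(3) by (cases "nX u") auto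
  have bound: "nX (\<lambda>x. ereal a * u x + w n x) \<le> ennreal (c * (a * r + e n))" if "0 \<le> a" for a n
  proof -
    have "nX (\<lambda>x. ereal a * u x + w n x) \<le> ennreal c * (nX (\<lambda>x. ereal a * u x) + nX (w n))"
      using u w by (intro norm_add) auto
    also have "\<dots> \<le> ennreal c * (ennreal (a * r) + ennreal (e n))"
      using norm_cmult[OF u(1), of a] w_le that r
      by (intro mult_left_mono add_mono) (auto simp: ennreal_mult')
    also have "\<dots> = ennreal (c * (a * r + e n))"
      using that r e(2) c_nonneg by (simp add: ennreal_plus[symmetric] ennreal_mult'[symmetric] del: ennreal_plus)
    finally show ?thesis .
  qed
  show "u \<in> lattice_X mu nX"
    using u by (simp add: lattice_X_def)
  show "f n \<in> lattice_X mu nX" for n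
  proof -
    have "nX (f n) \<le> nX (\<lambda>x. ereal (1 + e n) * u x + w n x)"
    proof (intro norm_mono AE_I2)
      fix x
      have "0 \<le> f n x"
        using u(2)[of x] lower[of x n] by (rule order_trans)
      then show "\<bar>f n x\<bar> \<le> \<bar>ereal (1 + e n) * u x + w n x\<bar>"
        using upper[of n x] by simp
    qed (use u f w in auto)
    also have "\<dots> \<le> ennreal (c * ((1 + e n) * r + e n))"
      using e(2) by (intro bound) (simp add: add_nonneg_nonneg)
    finally show ?thesis
      using f by (auto simp: lattice_X_def intro: le_less_trans)
  qed
  have le: "nX (\<lambda>x. f n x - u x) \<le> ennreal (c * (e n * r + e n))" for n
  proof -
    have "nX (\<lambda>x. f n x - u x) \<le> nX (\<lambda>x. ereal (e n) * u x + w n x)"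
    proof (rule norm_mono)
      \<comment> \<open>Subtracting \<open>u x\<close> from \<open>upper\<close> is legitimate only
        where \<open>u x\<close> is finite, which holds almost everywhere.\<close>
      show "AE x in mu. \<bar>f n x - u x\<bar> \<le> \<bar>ereal (e n) * u x + w n x\<bar>"
        using norm_finite_AE[OF u(1,3)]
      proof eventually_elim
        case (elim x)
        then obtain a where a: "u x = ereal a"
          by auto
        show ?case
          using a lower[of x n] upper[of n x] w_nonneg[of n x] u(2)[of x] e(2)[of n]
          by (cases "f n x"; cases "w n x") (auto simp: algebra_simps)
      qed
    qed (use u f w in auto)
    then show ?thesis
      using bound[OF e(2)] by (rule order_trans)
  qed
  show "(\<lambda>n. nX (\<lambda>x. f n x - u x)) \<longlonglongrightarrow> 0"
  proof (rule tendsto_sandwich[where f = "\<lambda>_. 0" and h = "\<lambda>n. ennreal (c * (e n * r + e n))"])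
    have "(\<lambda>n. c * (e n * r + e n)) \<longlonglongrightarrow> c * (0 * r + 0)"
      by (intro tendsto_intros e)
    then show "(\<lambda>n. ennreal (c * (e n * r + e n))) \<longlonglongrightarrow> 0"
      using tendsto_ennrealI by fastforce
    show "\<forall>\<^sub>F n in sequentially. 0 \<le> nX (\<lambda>x. f n x - u x)"
      by simp
    show "\<forall>\<^sub>F n in sequentially. nX (\<lambda>x. f n x - u x) \<le> ennreal (c * (e n * r + e n))"
      using le by simp
  qed simp
qed

text \<open>The superlevel set is the trace on \<open>M - G\<close> of an open set \<open>T\<close>;
  adding \<open>G\<close> restores the missing part, so the union is
  \<open>G \<union> T\<close>.\<close>

lemma openin_superlevel_Un:
  assumes G: "openin mtopology G" and u: "cont_off M d G u"
  shows "openin mtopology (G \<union> {x \<in> M - G. ereal a < u x})"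
proof -
  have "openin (subtopology mtopology (M - G))
      {x \<in> topspace (subtopology mtopology (M - G)). real_of_ereal (u x) \<in> {a<..}}"
    using u by (intro openin_continuous_map_preimage[of _ euclideanreal]) (auto simp: cont_off_def)
  moreover have "{x \<in> topspace (subtopology mtopology (M - G)). real_of_ereal (u x) \<in> {a<..}}
      = {x \<in> M - G. ereal a < u x}"
  proof -
    have "ereal a < u x \<longleftrightarrow> a < real_of_ereal (u x)" if "x \<in> M - G" for x
    proof -
      have "\<bar>u x\<bar> \<noteq> \<infinity>"
        using u that by (simp add: cont_off_def)
      then show ?thesis
        by (cases "u x") auto
    qed
    then show ?thesis
      by auto
  qed
  ultimately obtain T where T: "openin mtopology T" "{x \<in> M - G. ereal a < u x} = T \<inter> (M - G)"
    by (auto simp: openin_subtopology)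
  have "G \<union> {x \<in> M - G. ereal a < u x} = G \<union> T"
    using T(2) openin_subset[OF T(1)] by auto
  then show ?thesis
    using G T(1) by auto
qed

lemma propA_imp_propB:
  assumes "propA M d mu nX"
  shows "propB M d mu nX"
  unfolding propB_def quasiouter_c_def
proof (intro conjI allI impI)
  fix E assume "E \<subseteq> M"
  \<comment> \<open>It suffices to bound the infimum by each \<open>y > cap E\<close>, which leaves
    room for an almost optimal \<open>u\<close>.\<close>
  have "(INF G\<in>{G. openin mtopology G \<and> E \<subseteq> G}. cap G) \<le> y" if "cap E < y" for y
  proof -
    obtain u g where u: "u \<in> borel_measurable mu" "\<And>x. 0 \<le> u x \<and> u x \<le> 1" "\<And>x. x \<in> E \<Longrightarrow> 1 \<le> u x"
      and g: "ug g u" and less: "nX u + nX (\<lambda>x. enn2ereal (g x)) < y"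
      using \<open>cap E < y\<close> by (elim capX_lessE) blast
    have fin: "nX u + nX (\<lambda>x. enn2ereal (g x)) < \<infinity>"
      using less by (rule less_le_trans) simp
    then have fin': "nX u < \<infinity>" "nX (\<lambda>x. enn2ereal (g x)) < \<infinity>"
      by auto
    have "N1norm M d nX u \<le> nX u + nX (\<lambda>x. enn2ereal (g x))"
      unfolding N1norm_def using g by (intro add_left_mono INF_lower) auto
    with fin have "u \<in> N1"
      using u(1) fin'(1) by (auto simp: N1X_def lattice_X_def intro: le_less_trans)
    then have qc: "quasicont M d mu nX u"
      using assms by (simp add: propA_def)
    \<comment> \<open>\<open>e n\<close> serves both as the relative enlargement of \<open>u\<close>
      and as the bound for the capacity of \<open>G n\<close>.\<close>
    define e :: "nat \<Rightarrow> real" where "e n = (1 / 2) ^ n" for n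
    have e: "e \<longlonglongrightarrow> 0" "0 < e n" for n
      unfolding e_def by (auto intro: LIMSEQ_power_zero)
    have "\<exists>G. openin mtopology G \<and> cap G < ennreal (e n) \<and> cont_off M d G u" for n
      using qc e(2)[of n] by (auto simp: quasicont_def)
    then obtain G where G: "\<And>n. openin mtopology (G n)" "\<And>n. cap (G n) < ennreal (e n)"
      "\<And>n. cont_off M d (G n) u"
      by metis
    have "\<exists>w h. w \<in> borel_measurable mu \<and> (\<forall>x. 0 \<le> w x \<and> w x \<le> 1) \<and> (\<forall>x\<in>G n. 1 \<le> w x) \<and>
        ug h w \<and> nX w + nX (\<lambda>x. enn2ereal (h x)) < ennreal (e n)" for n
      using G(2)[of n] by (elim capX_lessE) blast
    then obtain w h where w: "\<And>n. w n \<in> borel_measurable mu" "\<And>n x. 0 \<le> w n x \<and> w n x \<le> 1"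
        "\<And>n x. x \<in> G n \<Longrightarrow> 1 \<le> w n x"
      and h: "\<And>n. ug (h n) (w n)" and wh: "\<And>n. nX (w n) + nX (\<lambda>x. enn2ereal (h n x)) < ennreal (e n)"
      by metis
    have wh': "nX (w n) \<le> ennreal (e n)" "nX (\<lambda>x. enn2ereal (h n x)) \<le> ennreal (e n)" for n
      using ennreal_add_lessD[OF wh[of n]] by auto
    \<comment> \<open>The level lies below 1, so \<open>E\<close> is covered. On the superlevel part
      \<open>(1 + e n) * u >= 1\<close>, and on \<open>G n\<close> the function \<open>w n\<close>
      is at least 1; hence the maximum \<open>f n\<close> is admissible for
      \<open>U n\<close>.\<close>
    define U where "U n = G n \<union> {x \<in> M - G n. ereal (1 / (1 + e n)) < u x}" for n
    define f where "f n x = max (min 1 (ereal (1 + e n) * \<bar>u x\<bar>)) (w n x)" for n x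
    define k where "k n x = max (ennreal (1 + e n) * g x) (h n x)" for n x
    have ug_f: "ug (k n) (f n)" for n
    proof -
      let ?g = "\<lambda>b x. if b then ennreal (1 + e n) * g x else h n x"
      let ?u = "\<lambda>b x. if b then min 1 (ereal (1 + e n) * \<bar>u x\<bar>) else w n x"
      have "ug (\<lambda>x. SUP b. ?g b x) (\<lambda>x. SUP b. ?u b x)"
      proof (rule upper_gradient_SUP)
        show "ug (?g b) (?u b)" for b
          using upper_gradient_truncate[OF g, of "1 + e n"] h[of n] e(2)[of n] by (cases b) auto
        show "0 \<le> ?u b x \<and> ?u b x \<le> 1" for b x
          using w(2)[of n x] e(2)[of n] by (cases b) (auto simp: min_def ereal_zero_le_0_iff)
      qed
      then show ?thesis
        unfolding SUP_bool_eq_max k_def[abs_def] f_def[abs_def] .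
    qed
    have f_meas: "f n \<in> borel_measurable mu" for n
      unfolding f_def using u(1) w(1) by measurable
    have one_le_f: "1 \<le> f n x" if "x \<in> U n" for n x
    proof (cases "x \<in> G n")
      case True
      then show ?thesis
        using w(3) by (auto simp: f_def le_max_iff_disj)
    next
      case False
      with that have "ereal (1 / (1 + e n)) < u x"
        by (simp add: U_def)
      then have "1 \<le> ereal (1 + e n) * \<bar>u x\<bar>"
        using e(2)[of n] u(2)[of x] by (cases "u x") (auto simp: field_simps)
      then show ?thesis
        by (simp add: f_def le_max_iff_disj)
    qed
    have "E \<subseteq> U n" for n
    proof
      fix x assume "x \<in> E"
      have "ereal (1 / (1 + e n)) < 1"
        using e(2)[of n] by simp
      then have "ereal (1 / (1 + e n)) < u x"
        using u(3)[OF \<open>x \<in> E\<close>] by (rule less_le_trans)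
      then show "x \<in> U n"
        using \<open>x \<in> E\<close> \<open>E \<subseteq> M\<close> by (auto simp: U_def)
    qed
    moreover have "openin mtopology (U n)" for n
      unfolding U_def using G by (intro openin_superlevel_Un)
    moreover have "cap (U n) \<le> nX (f n) + nX (\<lambda>x. enn2ereal (k n x))" for n
      using f_meas one_le_f ug_f by (rule capX_le)
    ultimately have INF_le: "(INF G\<in>{G. openin mtopology G \<and> E \<subseteq> G}. cap G)
        \<le> nX (f n) + nX (\<lambda>x. enn2ereal (k n x))" for n
      by (intro INF_lower2[of "U n"]) auto
    have le_mult: "r \<le> ereal (1 + e n) * r" if "0 \<le> r" for r n
      using that e(2)[of n] by (cases r) (auto simp: algebra_simps)
    \<comment> \<open>The perturbation lemma is applied once to the functions, with error
      \<open>w n\<close>, and once to the gradients, with error \<open>h n\<close>.\<close>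
    have "(\<lambda>n. nX (f n)) \<longlonglongrightarrow> nX u"
    proof (rule norm_perturbation_tendsto)
      show "u x \<le> f n x" for n x
        using u(2)[of x] le_mult[of "u x" n] by (simp add: f_def le_max_iff_disj)
      show "f n x \<le> ereal (1 + e n) * u x + w n x" for n x
      proof -
        have "0 \<le> ereal (1 + e n) * u x"
          using u(2)[of x] le_mult[of "u x" n] by (meson order_trans)
        then show ?thesis
          using u(2)[of x] w(2)[of n x] by (auto simp: f_def min_le_iff_disj add_increasing add_increasing2)
      qed
    qed (use u w f_meas wh' e fin' in \<open>auto intro: less_imp_le\<close>)
    moreover have "(\<lambda>n. nX (\<lambda>x. enn2ereal (k n x))) \<longlonglongrightarrow> nX (\<lambda>x. enn2ereal (g x))"
    proof (rule norm_perturbation_tendsto)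
      have k: "enn2ereal (k n x) = max (ereal (1 + e n) * enn2ereal (g x)) (enn2ereal (h n x))" for n x
        using e(2)[of n] by (simp add: k_def enn2ereal_max enn2ereal_ennreal_mult del: ennreal_plus)
      show "enn2ereal (g x) \<le> enn2ereal (k n x)" for n x
        using le_mult[of "enn2ereal (g x)" n] by (simp add: k le_max_iff_disj)
      show "enn2ereal (k n x) \<le> ereal (1 + e n) * enn2ereal (g x) + enn2ereal (h n x)" for n x
      proof -
        have "0 \<le> ereal (1 + e n) * enn2ereal (g x)"
          using le_mult[of "enn2ereal (g x)" n] by (meson enn2ereal_nonneg order_trans)
        then show ?thesis
          by (auto simp: k add_increasing add_increasing2)
      qed
    qed (use upper_gradient_measurable[OF g] upper_gradient_measurable[OF h]
        upper_gradient_measurable[OF ug_f] wh' e fin' in \<open>auto intro: less_imp_le\<close>)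
    ultimately have "(\<lambda>n. nX (f n) + nX (\<lambda>x. enn2ereal (k n x)))
        \<longlonglongrightarrow> nX u + nX (\<lambda>x. enn2ereal (g x))"
      by (rule tendsto_add)
    then have "(INF G\<in>{G. openin mtopology G \<and> E \<subseteq> G}. cap G) \<le> nX u + nX (\<lambda>x. enn2ereal (g x))"
      by (rule LIMSEQ_le_const) (use INF_le in auto)
    with less show ?thesis
      by (meson less_imp_le order_trans)
  qed
  then show "(INF G\<in>{G. openin (mtop M d) G \<and> E \<subseteq> G}. cap G) \<le> ennreal 1 * cap E"
    by (simp add: dense_ge)
qed simp

section \<open>The remaining implications\<close>

lemma propC_imp_propE: "propC M d mu nX \<Longrightarrow> propE M d mu nX"
  unfolding propE_def
proof (intro allI impI)
  fix E and \<epsilon> :: ennreal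
  assume C: "propC M d mu nX" and E: "E \<subseteq> M" "cap E = 0" "0 < \<epsilon>"
  obtain a where "(INF G\<in>{G. openin (mtop M d) G \<and> E \<subseteq> G}. cap G) \<le> ennreal a * cap E"
    using C E(1) unfolding propC_def quasiouter_c_def by blast
  with E have "(INF G\<in>{G. openin (mtop M d) G \<and> E \<subseteq> G}. cap G) < \<epsilon>"
    by simp
  then show "\<exists>G. openin (mtop M d) G \<and> E \<subseteq> G \<and> cap G < \<epsilon>"
    by (auto simp: INF_less_iff)
qed

lemma propB_imp_propD:
  assumes "propB M d mu nX"
  shows "propD M d mu nX"
  unfolding propD_def quasicont_def
proof (intro allI impI)
  fix u and \<epsilon> :: ennreal
  assume "weakly_qc M d mu nX u" "0 < \<epsilon>"
  then obtain E where E: "E \<subseteq> M" "cap E < \<epsilon>" "cont_off M d E u"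
    by (auto simp: weakly_qc_def)
  have "(INF G\<in>{G. openin mtopology G \<and> E \<subseteq> G}. cap G) \<le> cap E"
    using assms E(1) by (simp add: propB_def quasiouter_c_def)
  then have "(INF G\<in>{G. openin mtopology G \<and> E \<subseteq> G}. cap G) < \<epsilon>"
    using E(2) by (rule le_less_trans)
  then obtain G where G: "openin mtopology G" "E \<subseteq> G" "cap G < \<epsilon>"
    by (auto simp: INF_less_iff)
  with E(3) have "cont_off M d G u"
    by (auto intro: cont_off_cong_superset)
  with G show "\<exists>G. openin (mtop M d) G \<and> cap G < \<epsilon> \<and> cont_off M d G u"
    by auto
qed

text \<open>Two cycles through (A) and (B): (A), (B), (C), (E), (A) and (A), (B), (D), (A). Density
  enters in the steps back to (A), through (F) and (G).\<close>

lemma props_equivalent: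
  assumes "cont_dense M d mu nX"
  shows "(propA M d mu nX = propB M d mu nX) \<and> (propB M d mu nX = propC M d mu nX) \<and>
         (propC M d mu nX = propD M d mu nX) \<and> (propD M d mu nX = propE M d mu nX)"
proof -
  have "propB M d mu nX \<Longrightarrow> propC M d mu nX"
    by (auto simp: propB_def propC_def)
  moreover have "propD M d mu nX \<Longrightarrow> propA M d mu nX"
    using cont_dense_imp_propG[OF assms] by (simp add: propA_def propD_def propG_def)
  ultimately show ?thesis
    using propE_imp_propA[OF assms] propA_imp_propB propC_imp_propE propB_imp_propD by blast
qed

end

section \<open>A capacity that is not outer\<close>

lemma arclength_curve_dist_le:
  assumes "arclength_curve M d \<gamma> l" "0 \<le> s" "s \<le> t" "t \<le> l"
  shows "d (\<gamma> s) (\<gamma> t) \<le> t - s"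
proof -
  let ?p = "\<lambda>i::nat. if i = 0 then s else t"
  have "ereal (\<Sum>i<1. d (\<gamma> (?p i)) (\<gamma> (?p (Suc i)))) \<le> curve_length d \<gamma> s t"
    unfolding curve_length_def using assms(3) by (intro SUP_upper2[of "(?p, 1::nat)"]) auto
  then show ?thesis
    using assms by (simp add: arclength_curve_def)
qed

text \<open>An arc-length curve is 1-Lipschitz, so its image is connected; being countable, it is a
  single point. The length would then be 0 instead of \<open>l > 0\<close>.\<close>

lemma no_arclength_curve_countable:
  fixes M :: "'a::metric_space set"
  assumes "countable M"
  shows "\<not> arclength_curve M dist \<gamma> l"
proof
  assume \<gamma>: "arclength_curve M dist \<gamma> l"
  have le: "dist (\<gamma> s) (\<gamma> t) \<le> dist s t" if "s \<in> {0..l}" "t \<in> {0..l}" for s t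
    using arclength_curve_dist_le[OF \<gamma>, of s t] arclength_curve_dist_le[OF \<gamma>, of t s] that
    by (cases "s \<le> t") (auto simp: dist_real_def dist_commute)
  have "continuous_on {0..l} \<gamma>"
    unfolding continuous_on_iff using le by (meson le_less_trans)
  then have "connected (\<gamma> ` {0..l})"
    by (rule connected_continuous_image) simp
  moreover have "countable (\<gamma> ` {0..l})"
    using \<gamma> assms by (auto simp: arclength_curve_def intro: countable_subset)
  ultimately have const: "\<gamma> s = \<gamma> t" if "s \<in> {0..l}" "t \<in> {0..l}" for s t
    using connected_uncountable that by blast
  have "curve_length dist \<gamma> 0 l \<le> 0"
    unfolding curve_length_def
  proof (rule SUP_least)
    fix z assume "z \<in> {(p :: nat \<Rightarrow> real, n :: nat). p 0 = 0 \<and> p n = l \<and> (\<forall>i<n. p i \<le> p (Suc i))}"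
    then obtain p n where z: "z = (p, n)" and p: "p 0 = 0" "p n = l" "\<forall>i<n. p i \<le> p (Suc i)"
      by auto
    have mono: "p i \<le> p j" if "i \<le> j" "j \<le> n" for i j
      using that by (induction j rule: dec_induct) (use p(3) in \<open>auto intro: order_trans\<close>)
    have "p i \<in> {0..l}" if "i \<le> n" for i
      using mono[of 0 i] mono[of i n] that p(1,2) by simp
    then have "dist (\<gamma> (p i)) (\<gamma> (p (Suc i))) = 0" if "i < n" for i
      using const[of "p i" "p (Suc i)"] that by simp
    then show "(case z of (p, n) \<Rightarrow> ereal (\<Sum>i<n. dist (\<gamma> (p i)) (\<gamma> (p (Suc i))))) \<le> 0"
      by (simp add: z)
  qed
  moreover have "curve_length dist \<gamma> 0 l = ereal l" "0 < l"
    using \<gamma> by (auto simp: arclength_curve_def)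
  ultimately show False
    by simp
qed

section \<open>The compact space of the counterexample and its measure\<close>

definition halves :: "nat \<Rightarrow> real" where
  "halves n = (1 / 2) ^ n"

definition halves_space :: "real set" where
  "halves_space = insert 0 (range halves)"

text \<open>The geometric distribution gives each \<open>halves n\<close> positive mass and the
  point 0 none. With all subsets measurable, completeness and measurability are automatic.\<close>

definition halves_measure :: "real measure" where
  "halves_measure = distr (measure_pmf (geometric_pmf (1 / 2))) (count_space halves_space) halves"

definition ereal_size :: "ereal \<Rightarrow> ennreal" where
  "ereal_size r = e2ennreal \<bar>r\<bar>"

text \<open>The l1 norm along the sequence, blind to the value at 0; as an integral against counting
  measure it inherits the convergence theorems.\<close>

definition halves_norm :: "(real \<Rightarrow> ereal) \<Rightarrow> ennreal" where
  "halves_norm u = (\<integral>\<^sup>+ n. ereal_size (u (halves n)) \<partial>count_space UNIV)"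

lemma ereal_size_eq_0 [simp]: "ereal_size r = 0 \<longleftrightarrow> r = 0"
  by (cases r) (auto simp: ereal_size_def)

lemma ereal_size_mult: "ereal_size (ereal a * r) = ennreal \<bar>a\<bar> * ereal_size r"
  by (cases r) (auto simp: ereal_size_def abs_mult ennreal_mult ennreal_mult_top)

lemma ereal_size_add: "ereal_size (r + s) \<le> ereal_size r + ereal_size s"
  by (cases r; cases s) (auto simp: ereal_size_def ennreal_plus[symmetric] simp del: ennreal_plus intro!: ennreal_leI)

lemma ereal_size_diff_triangle:
  "ereal_size r \<le> ereal_size s + ereal_size (r - s)"
  "ereal_size s \<le> ereal_size r + ereal_size (r - s)"
  by (cases r; cases s;
      auto simp: ereal_size_def ennreal_plus[symmetric] simp del: ennreal_plus intro!: ennreal_leI)+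

lemma ereal_size_mono: "\<bar>r\<bar> \<le> \<bar>s\<bar> \<Longrightarrow> ereal_size r \<le> ereal_size s"
  by (simp add: ereal_size_def e2ennreal_mono)

lemma ereal_size_suminf:
  assumes "\<And>n. 0 \<le> f n"
  shows "ereal_size (\<Sum>n. f n) = (\<Sum>n. ereal_size (f n))"
proof -
  define g where "g n = e2ennreal (f n)" for n
  have g: "f = (\<lambda>n. enn2ereal (g n))"
    using assms by (simp add: g_def enn2ereal_e2ennreal)
  show ?thesis
    by (simp add: g ereal_size_def)
qed

lemma halves_pos: "0 < halves n" and halves_inj: "inj halves" and halves_tendsto: "halves \<longlonglongrightarrow> 0"
proof -
  show "0 < halves n"
    by (simp add: halves_def)
  show "inj halves"
    using power_strict_decreasing[of _ _ "1 / 2 :: real"]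
    by (intro linorder_injI) (fastforce simp: halves_def)
  show "halves \<longlonglongrightarrow> 0"
    unfolding halves_def by (intro LIMSEQ_power_zero) simp
qed

lemma halves_in_space [simp]: "halves n \<in> halves_space"
  by (simp add: halves_space_def)

lemma space_halves_measure [simp]: "space halves_measure = halves_space"
  and sets_halves_measure [simp]: "sets halves_measure = Pow halves_space"
  by (simp_all add: halves_measure_def)

lemma measurable_halves_measure [simp]: "u \<in> borel_measurable halves_measure"
  by (auto simp: measurable_def)

lemma AE_halves_measure: "(AE x in halves_measure. P x) \<longleftrightarrow> (\<forall>n. P (halves n))"
proof -
  have "(AE x in halves_measure. P x) \<longleftrightarrow> (AE n in measure_pmf (geometric_pmf (1 / 2)). P (halves n))"
    unfolding halves_measure_def by (rule AE_distr_iff) auto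
  then show ?thesis
    by (simp add: AE_measure_pmf_iff set_pmf_geometric)
qed

interpretation halves: Submetric UNIV "dist :: real \<Rightarrow> real \<Rightarrow> real" halves_space
  by unfold_locales auto

lemma mtop_halves: "mtop halves_space dist = top_of_set halves_space"
  using halves.mtopology_submetric by (simp add: mtop_def)

lemma compact_halves_space: "compact halves_space"
  unfolding halves_space_def using halves_tendsto by (rule compact_sequence_with_limit)

lemma standing_halves: "standing halves_space dist halves_measure"
  unfolding standing_def
proof (intro conjI ballI allI impI)
  show "Metric_space halves_space (dist :: real \<Rightarrow> real \<Rightarrow> real)"
    by (rule halves.sub.Metric_space_axioms)
  have "{U. openin (mtop halves_space dist) U} \<subseteq> Pow halves_space"
    using openin_imp_subset by (auto simp: mtop_halves)
  from sigma_sets_into_sp[OF this]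
  show "sets (borel_mspace halves_space dist) \<subseteq> sets halves_measure"
    using \<open>{U. openin (mtop halves_space dist) U} \<subseteq> Pow halves_space\<close>
    by (auto simp: borel_mspace_def sets_measure_of)
  show "complete_measure halves_measure"
    by unfold_locales (use sets.sets_into_space in fastforce)
next
  fix x r :: real assume x: "x \<in> halves_space" and r: "0 < r"
  let ?B = "halves.sub.mball x r"
  \<comment> \<open>Every ball contains a charged point: its centre, or, for centre 0, a late term
    of the sequence.\<close>
  have "\<exists>n. halves n \<in> ?B"
  proof (cases "x = 0")
    case True
    have "eventually (\<lambda>n. halves n < r) sequentially"
      using halves_tendsto r by (rule order_tendstoD)
    then obtain n where "halves n < r"
      using eventually_happens'[OF sequentially_bot] by blast
    then show ?thesis
      using x True halves_pos[of n] by (auto simp: dist_real_def intro!: exI[of _ n])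
  next
    case False
    then obtain n where "x = halves n"
      using x by (auto simp: halves_space_def)
    then show ?thesis
      using x r by (intro exI[of _ n]) simp
  qed
  then have "\<not> (AE x in halves_measure. x \<notin> ?B)"
    by (simp add: AE_halves_measure)
  moreover have "?B \<in> sets halves_measure"
    by auto
  ultimately show "0 < emeasure halves_measure ?B"
    by (metis AE_iff_null_sets null_setsI zero_less_iff_neq_zero)
  interpret prob_space halves_measure
    unfolding halves_measure_def by (rule measure_pmf.prob_space_distr) auto
  show "emeasure halves_measure ?B < \<infinity>"
    by (simp add: less_top[symmetric])
qed simp

lemma halves_norm_mono: "(\<And>n. \<bar>u (halves n)\<bar> \<le> \<bar>v (halves n)\<bar>) \<Longrightarrow> halves_norm u \<le> halves_norm v"
  unfolding halves_norm_def by (intro nn_integral_mono ereal_size_mono)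

section \<open>The Banach function lattice axioms for the l1 norm\<close>

lemma qBFL_halves: "qBFL halves_measure halves_norm 1"
  unfolding qBFL_def
proof (intro conjI ballI allI impI)
  fix u
  show "halves_norm u = 0 \<longleftrightarrow> (AE x in halves_measure. u x = 0)"
    by (simp add: halves_norm_def nn_integral_0_iff_AE AE_count_space AE_halves_measure)
next
  fix u :: "real \<Rightarrow> ereal" and a :: real
  show "halves_norm (\<lambda>x. ereal a * u x) = ennreal \<bar>a\<bar> * halves_norm u"
    by (simp add: halves_norm_def ereal_size_mult nn_integral_cmult)
next
  fix u v :: "real \<Rightarrow> ereal"
  have "halves_norm (\<lambda>x. u x + v x)
      \<le> (\<integral>\<^sup>+ n. ereal_size (u (halves n)) + ereal_size (v (halves n)) \<partial>count_space UNIV)"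
    unfolding halves_norm_def by (intro nn_integral_mono ereal_size_add)
  then show "halves_norm (\<lambda>x. u x + v x) \<le> ennreal 1 * (halves_norm u + halves_norm v)"
    by (simp add: halves_norm_def nn_integral_add)
next
  fix u v :: "real \<Rightarrow> ereal"
  assume "AE x in halves_measure. \<bar>u x\<bar> \<le> \<bar>v x\<bar>"
  then show "halves_norm u \<le> halves_norm v"
    by (intro halves_norm_mono) (simp add: AE_halves_measure)
next
  fix us :: "nat \<Rightarrow> real \<Rightarrow> ereal"
  assume "\<forall>n. AE x in halves_measure. 0 \<le> us n x"
  then have "ereal_size (\<Sum>i. us i (halves n)) = (\<Sum>i. ereal_size (us i (halves n)))" for n
    by (intro ereal_size_suminf) (simp add: AE_halves_measure)
  then show "halves_norm (\<lambda>x. \<Sum>n. us n x) \<le> (\<Sum>n. ennreal (1 ^ Suc n) * halves_norm (us n))"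
    by (simp add: halves_norm_def nn_integral_suminf)
next
  fix u :: "real \<Rightarrow> ereal" and us
  assume u: "u \<in> lattice_X halves_measure halves_norm"
    and lim: "(\<lambda>n. halves_norm (\<lambda>x. us n x - u x)) \<longlonglongrightarrow> 0"
  let ?e = "\<lambda>n. halves_norm (\<lambda>x. us n x - u x)"
  have upper: "halves_norm (us n) \<le> halves_norm u + ?e n" for n
    unfolding halves_norm_def
    by (subst nn_integral_add[symmetric]) (auto intro!: nn_integral_mono ereal_size_diff_triangle)
  have "halves_norm u \<le> halves_norm (us n) + ?e n" for n
    unfolding halves_norm_def
    by (subst nn_integral_add[symmetric]) (auto intro!: nn_integral_mono ereal_size_diff_triangle)
  \<comment> \<open>Rearranging with the subtraction of \<open>ennreal\<close> uses that
    \<open>halves_norm u\<close> is finite; \<open>lower\<close> and \<open>upper\<close> then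
    squeeze the norms.\<close>
  then have lower: "halves_norm u - ?e n \<le> halves_norm (us n)" for n
    using u by (auto simp: ennreal_minus_le_iff lattice_X_def add.commute)
  show "(\<lambda>n. halves_norm (us n)) \<longlonglongrightarrow> halves_norm u"
  proof (rule tendsto_sandwich)
    show "\<forall>\<^sub>F n in sequentially. halves_norm u - ?e n \<le> halves_norm (us n)"
      using lower by simp
    show "\<forall>\<^sub>F n in sequentially. halves_norm (us n) \<le> halves_norm u + ?e n"
      using upper by simp
    show "(\<lambda>n. halves_norm u - ?e n) \<longlonglongrightarrow> halves_norm u"
      using tendsto_diff_ennreal[OF tendsto_const lim, of "halves_norm u"] u
      by (auto simp: lattice_X_def)
    show "(\<lambda>n. halves_norm u + ?e n) \<longlonglongrightarrow> halves_norm u"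
      using tendsto_add[OF tendsto_const lim, of "halves_norm u"] by simp
  qed
qed simp

lemma countable_halves_space: "countable halves_space"
  by (simp add: halves_space_def)

section \<open>Density of continuous functions and failure of (E)\<close>

text \<open>In the absence of curves the zero function is an upper gradient of every
  function.\<close>

lemma N1norm_halves [simp]: "N1norm halves_space dist halves_norm u = halves_norm u"
proof -
  have "upper_gradient halves_space dist (\<lambda>x. 0) u"
    by (simp add: upper_gradient_def no_arclength_curve_countable[OF countable_halves_space])
  then have "(INF g\<in>{g. upper_gradient halves_space dist g u}. halves_norm (\<lambda>x. enn2ereal (g x)))
      \<le> halves_norm (\<lambda>x. enn2ereal 0)"
    by (intro INF_lower) simp
  also have "\<dots> = 0"
    by (simp add: halves_norm_def zero_ennreal.rep_eq)
  finally show ?thesis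
    by (simp add: N1norm_def)
qed

lemma N1X_halves: "N1X halves_space dist halves_measure halves_norm = {u. halves_norm u < \<infinity>}"
  by (auto simp: N1X_def lattice_X_def)

lemma cont_dense_halves: "cont_dense halves_space dist halves_measure halves_norm"
  unfolding cont_dense_def N1X_halves N1norm_halves
proof (intro ballI allI impI)
  fix u and \<epsilon> :: ennreal
  assume "u \<in> {u. halves_norm u < \<infinity>}" and \<epsilon>: "0 < \<epsilon>"
  then have fin: "halves_norm u < \<infinity>"
    by simp
  \<comment> \<open>Cutting \<open>u\<close> off after \<open>N\<close> points, and to 0 at the
    point 0, makes it vanish near the only accumulation point.\<close>
  define v where "v N x = (if x \<in> halves ` {..<N} then u x else 0)" for N :: nat and x
  have v_halves: "v N (halves n) = (if n < N then u (halves n) else 0)" for N n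
    using halves_inj by (auto simp: v_def inj_eq)
  have "AE n in count_space UNIV. ereal_size (u (halves n)) \<noteq> \<infinity>"
    using fin by (intro nn_integral_PInf_AE) (auto simp: halves_norm_def)
  then have u_fin: "\<bar>u (halves n)\<bar> \<noteq> \<infinity>" for n
    by (auto simp: AE_count_space ereal_size_def dest!: spec[of _ n])
  have v_fin: "\<bar>v N x\<bar> \<noteq> \<infinity>" for N x
  proof (cases "x \<in> halves ` {..<N}")
    case True
    then obtain n where "x = halves n"
      by blast
    with True show ?thesis
      using u_fin[of n] by (simp only: v_def if_True not_False_eq_True)
  qed (simp add: v_def)
  have cont: "cont_off halves_space dist {} (v N)" for N
  proof -
    define A where "A = halves ` {..<N}"
    \<comment> \<open>The space is the union of the closed sets \<open>A\<close>, finite, and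
      \<open>B\<close>, where \<open>v N\<close> vanishes; continuity on each is pasted
      together.\<close>
    define B where "B = insert 0 (range (\<lambda>n. halves (n + N)))"
    have "closed A"
      by (simp add: A_def finite_imp_closed)
    moreover have "closed B"
      unfolding B_def
      by (intro compact_imp_closed compact_sequence_with_limit LIMSEQ_ignore_initial_segment halves_tendsto)
    moreover have "continuous_on A (\<lambda>x. real_of_ereal (v N x))"
      by (simp add: A_def continuous_on_finite)
    moreover have "v N x = 0" if "x \<in> B" for x
      using that halves_pos by (auto simp: B_def v_halves) (auto simp: v_def less_le)
    then have "continuous_on B (\<lambda>x. real_of_ereal (v N x))"
      by (simp cong: continuous_on_cong_simp)
    ultimately have "continuous_on (A \<union> B) (\<lambda>x. real_of_ereal (v N x))"
      by (rule continuous_on_closed_Un)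
    moreover have "halves_space = A \<union> B"
    proof -
      have "halves n \<in> A \<union> B" for n
        by (cases "n < N") (auto simp: A_def B_def intro!: rev_image_eqI[of "n - N"])
      then show ?thesis
        by (auto simp: halves_space_def A_def B_def)
    qed
    ultimately show ?thesis
      using v_fin by (simp add: cont_off_def mtop_halves subtopology_subtopology)
  qed
  \<comment> \<open>Dominated convergence with majorant \<open>u\<close>: at each point the
    difference is 0 once \<open>N > n\<close>.\<close>
  have "(\<lambda>N. halves_norm (\<lambda>x. u x - v N x)) \<longlonglongrightarrow> (\<integral>\<^sup>+ n. 0 \<partial>count_space (UNIV :: nat set))"
    unfolding halves_norm_def
  proof (rule nn_integral_dominated_convergence)
    show "(\<integral>\<^sup>+ n. ereal_size (u (halves n)) \<partial>count_space UNIV) < \<infinity>"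
      using fin by (simp add: halves_norm_def)
    show "AE n in count_space UNIV. ereal_size (u (halves n) - v N (halves n)) \<le> ereal_size (u (halves n))" for N
      by (rule AE_I2, rule ereal_size_mono) (use u_fin in \<open>auto simp: v_halves\<close>)
    show "AE n in count_space UNIV. (\<lambda>N. ereal_size (u (halves n) - v N (halves n))) \<longlonglongrightarrow> 0"
    proof (rule AE_I2)
      fix n
      have "\<forall>\<^sub>F N in sequentially. ereal_size (u (halves n) - v N (halves n)) = 0"
        using eventually_gt_at_top[of n] by eventually_elim (use u_fin in \<open>simp add: v_halves\<close>)
      then show "(\<lambda>N. ereal_size (u (halves n) - v N (halves n))) \<longlonglongrightarrow> 0"
        by (rule tendsto_eventually)
    qed
  qed auto
  then have "\<forall>\<^sub>F N in sequentially. halves_norm (\<lambda>x. u x - v N x) < \<epsilon>"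
    using \<epsilon> by (intro order_tendstoD(2)) auto
  then obtain N where N: "halves_norm (\<lambda>x. u x - v N x) < \<epsilon>"
    using eventually_happens'[OF sequentially_bot] by blast
  have "halves_norm (v N) \<le> halves_norm u"
    by (rule halves_norm_mono) (simp add: v_halves)
  with fin have "halves_norm (v N) < \<infinity>"
    by (rule le_less_trans[rotated])
  with N cont show "\<exists>v\<in>{u. halves_norm u < \<infinity>}. cont_off halves_space dist {} v \<and> halves_norm (\<lambda>x. u x - v x) < \<epsilon>"
    by blast
qed

lemma not_propE_halves: "\<not> propE halves_space dist halves_measure halves_norm"
proof
  assume E: "propE halves_space dist halves_measure halves_norm"
  let ?cap = "capX halves_space dist halves_measure halves_norm"
  \<comment> \<open>Admissible for \<open>{0}\<close> and of norm 0, since it vanishes at every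
    \<open>halves n\<close>.\<close>
  let ?u = "\<lambda>x::real. if x = 0 then 1 else 0 :: ereal"
  have "halves_norm ?u = 0"
    using halves_pos by (simp add: halves_norm_def less_le)
  then have "?cap {0} \<le> 0"
    unfolding capX_def N1X_halves N1norm_halves by (intro INF_lower2[of ?u]) auto
  then have "?cap {0} = 0"
    by simp
  moreover have "{0} \<subseteq> halves_space"
    by (simp add: halves_space_def)
  ultimately obtain G where G: "openin (top_of_set halves_space) G" "0 \<in> G" "?cap G < 1"
    using E unfolding propE_def mtop_halves by (metis insert_subset zero_less_one)
  obtain u where u: "halves_norm u < \<infinity>" "\<And>x. x \<in> G \<Longrightarrow> 1 \<le> u x"
    using G(3) unfolding capX_def N1X_halves by (auto simp: INF_less_iff)
  obtain T where T: "open T" "G = halves_space \<inter> T"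
    using G(1) by (auto simp: openin_open)
  then have "\<forall>\<^sub>F n in sequentially. halves n \<in> T"
    using G(2) by (intro topological_tendstoD[OF halves_tendsto]) auto
  then obtain N where N: "halves n \<in> G" if "N \<le> n" for n
    using T(2) by (auto simp: eventually_sequentially)
  have "1 \<le> ereal_size r" if "1 \<le> r" for r :: ereal
    using that e2ennreal_mono[of 1 "\<bar>r\<bar>"] by (cases r) (auto simp: ereal_size_def one_ereal_def)
  \<comment> \<open>\<open>u\<close> is at least 1 on a whole tail of the sequence, so its norm
    dominates the counting measure of an infinite set.\<close>
  then have "(\<integral>\<^sup>+ n. indicator {N..} n \<partial>count_space UNIV) \<le> halves_norm u"
    unfolding halves_norm_def using u(2) N by (intro nn_integral_mono) (auto simp: indicator_def)
  then have "halves_norm u = \<infinity>"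
    by (simp add: emeasure_count_space infinite_Ici top_unique)
  with u(1) show False
    by simp
qed

theorem theorem1p6:
  shows "(\<forall>(M :: 'a set) d mu nX c.
            standing M d mu \<longrightarrow> qBFL mu nX c \<longrightarrow> cont_dense M d mu nX \<longrightarrow>
              (propA M d mu nX = propB M d mu nX) \<and>
              (propB M d mu nX = propC M d mu nX) \<and>
              (propC M d mu nX = propD M d mu nX) \<and>
              (propD M d mu nX = propE M d mu nX) \<and>
              propF M d mu nX \<and> propG M d mu nX)
       \<and> (\<exists>(M :: real set) d mu nX.
            standing M d mu \<and> compact_space (mtop M d) \<and> qBFL mu nX 1 \<and>
            cont_dense M d mu nX \<and>
            \<not> propA M d mu nX \<and> \<not> propB M d mu nX \<and> \<not> propC M d mu nX \<and>
            \<not> propD M d mu nX \<and> \<not> propE M d mu nX)"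
proof (intro conjI allI impI)
  fix M :: "'a set" and d mu nX c
  assume "standing M d mu" "qBFL mu nX c" and dense: "cont_dense M d mu nX"
  then interpret function_lattice_space M d mu nX c
    by unfold_locales
  show "propA M d mu nX = propB M d mu nX" "propB M d mu nX = propC M d mu nX"
    "propC M d mu nX = propD M d mu nX" "propD M d mu nX = propE M d mu nX"
    using props_equivalent[OF dense] by auto
  show "propF M d mu nX" "propG M d mu nX"
    using dense by (rule cont_dense_imp_propF, rule cont_dense_imp_propG)
next
  interpret function_lattice_space halves_space dist halves_measure halves_norm 1
    using standing_halves qBFL_halves by unfold_locales
  have "compact_space (mtop halves_space dist)"
    using compact_halves_space by (simp only: mtop_halves compact_space_subtopology compactin_euclidean_iff)
  \<comment> \<open>Density makes the five properties equivalent here, so the failure of (E) alone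
    refutes them all.\<close>
  then show "\<exists>(M :: real set) d mu nX.
            standing M d mu \<and> compact_space (mtop M d) \<and> qBFL mu nX 1 \<and>
            cont_dense M d mu nX \<and>
            \<not> propA M d mu nX \<and> \<not> propB M d mu nX \<and> \<not> propC M d mu nX \<and>
            \<not> propD M d mu nX \<and> \<not> propE M d mu nX"
    using standing_halves qBFL_halves cont_dense_halves not_propE_halves
      props_equivalent[OF cont_dense_halves] by blast
qed

end
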